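(* Let the data be as in the context, let $\varepsilon,\varepsilon_{\rm el},\varepsilon_{\rm p},\sigma\in W^{1,\infty}(I,\mathcal{H})$ and $\xi\in W^{1,\infty}(I,\mathcal{H}')$, where $\bm{\varepsilon_{\bf el}}=\mathbf{C}^{-1}\bm\sigma$ and $\bm{\varepsilon_{\bf p}}=\bm\varepsilon-\bm{\varepsilon_{\bf el}}$, and put $y=\sigma-\widetilde\sigma\in W^{1,\infty}(I,\mathcal{H}_{\mathbf{C}^{-1}})$. Then $(\varepsilon,\varepsilon_{\rm el},\varepsilon_{\rm p},\sigma,\xi)$ solves the abstract problem of quasi-static evolution in elasticity-monotone plasticity if and only if $y$, $\varepsilon$ and $\xi$ solve the differential inclusions (for a.a. $t\in I$) $$-\frac{d}{dt}\begin{pmatrix}\bm y\\ \bm\xi\end{pmatrix}\in N^{\widehat{\mathbf C}^{-1}}_{\widehat{\mathcal C}(t)}\begin{pmatrix}\bm y\\ \bm\xi\end{pmatrix},$$ $$\frac{d}{dt}\bm\varepsilon\in\mathbf{C}^{-1}\left(P_1\left(\left(N^{\widehat{\mathbf C}^{-1}}_{\widehat\Sigma-\begin{pmatrix}\bm{\widetilde\sigma}(t)\\0\end{pmatrix}}\begin{pmatrix}\bm y\\ \bm\xi\end{pmatrix}+\frac{d}{dt}\begin{pmatrix}\bm y\\ \bm\xi\end{pmatrix}\right)\cap(\mathcal{U}\times\{0\})\right)+\frac{d}{dt}\bm{\widetilde\sigma}(t)\right),$$ where $$\widehat{\mathcal C}(t)=\left(\widehat\Sigma-\begin{pmatrix}\bm{\widetilde\sigma}(t)\\0\end{pmatrix}\right)\cap(\mathcal{V}\times\mathcal{H}')$$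 and $(\bm y(t),\bm\xi(t))\in\widehat{\mathcal C}(t)$ is required for all $t\in I$, with the initial conditions $$\bm y(0)=\bm\sigma_{\bf 0}-\bm{\widetilde\sigma}(0),\quad\bm\xi(0)=\bm\xi_{\bf 0},\quad\begin{pmatrix}\bm y(0)\\ \bm\xi(0)\end{pmatrix}\in\widehat{\mathcal C}(0),\quad\bm\varepsilon(0)=\bm\varepsilon_{\bf 0}\in\mathbf{C}^{-1}(\mathcal{U}+\bm{\widetilde\sigma}(0)).$$
   Context: All spaces are real and $I=[0,T]$ with $T>0$. For a function $h$ on $I$, $\bm h(t)$ denotes its value at $t$. Spaces and operators. $\mathcal{H}$ and $\mathcal{H}'$ are separable Hilbert spaces ($\mathcal{H}'$ is the space of internal variables), $\widehat{\mathcal H}=\mathcal{H}\times\mathcal{H}'$. $\mathcal{X}$ is a reflexive Banach space, $\mathcal{W}_0\subset\mathcal{X}$ is a linear (not necessarily closed) subspace, $\mathbf{E}:\mathcal{W}_0\subset\mathcal{X}\to\mathcal{H}$ is a linear operator which is closed (closed graph in $\mathcal X\times\mathcal H$) and has closed image. $\mathcal{X}_0=\overline{\mathcal{W}_0}$ (closure in $\mathcal{X}$). $\mathbf{D}:D(\mathbf{D})\subset\mathcal{H}\to\mathcal{X}_0^*$ is the adjoint, in the sense of unbounded operators, of $\mathbf{E}$ regarded as a densely defined operator from $\mathcal{X}_0$ to $\mathcal{H}$. $\mathbf{C}:\mathcal{H}\to\mathcal{H}$ is linear, bounded, symmetric, and coercive ($\langle\mathbf C\bm\tau,\bm\tau\rangle\ge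 c_0\|\bm\tau\|^2$ for some $c_0>0$). The loads are $g\in W^{1,\infty}(I,\mathcal{H})$ and $f\in W^{1,\infty}(I,\mathrm{Im}\,\mathbf{D})$. Weighted spaces. $\mathcal{H}_{\mathbf{C}^{-1}}$ is $\mathcal{H}$ with the inner product $\langle\bm\sigma,\bm\tau\rangle_{\mathbf{C}^{-1}}=\langle\bm\sigma,\mathbf{C}^{-1}\bm\tau\rangle_{\mathcal{H}}$. $\mathcal{U}=\mathrm{Im}(\mathbf{C}\mathbf{E})$ and $\mathcal{V}=\mathrm{Ker}\,\mathbf{D}$ are closed orthogonal complements of each other in $\mathcal{H}_{\mathbf{C}^{-1}}$; $P_{\mathcal V}$ is the orthogonal projection of $\mathcal{H}_{\mathbf{C}^{-1}}$ onto $\mathcal{V}$; $G=P_{\mathcal V}\mathbf{C}$; $Q:\mathrm{Im}\,\mathbf{D}\to\mathcal{U}$ is the (bounded) inverse of the bijection $\mathcal{U}\cap D(\mathbf{D})\to\mathrm{Im}\,\mathbf{D}$, $\bm\sigma\mapsto\mathbf{D}\bm\sigma$. The stress solution for elasticity is $\bm{\widetilde\sigma}(t)=G\bm g(t)+Q\bm f(t)$, which belongs to $W^{1,\infty}(I,\mathcal{H})$. $\widehat{\mathcal H}_{\mathbf{C}^{-1}}=\mathcal{H}_{\mathbf{C}^{-1}}\times\mathcal{H}'$, i.e. $\widehat{\mathcal H}$ with the inner product $\langle\bm\sigma,\mathbf{C}^{-1}\bm\tau\rangle_{\mathcal H}+\langle\bm\xi,\bm\zeta\rangle_{\mathcal{H}'}$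 of $(\bm\sigma,\bm\xi)$ and $(\bm\tau,\bm\zeta)$. $P_1:\widehat{\mathcal H}_{\mathbf{C}^{-1}}\to\mathcal{H}_{\mathbf{C}^{-1}}$, $P_1(\bm\sigma,\bm\xi)=\bm\sigma$. Normal cones. For a closed convex nonempty set $\mathcal{C}$ in a Hilbert space and $\bm x\in\mathcal{C}$, $N_{\mathcal C}(\bm x)=\{\bm z:\langle\bm z,\bm c-\bm x\rangle\le0\ \forall\bm c\in\mathcal{C}\}$; below $N_{\widehat\Sigma}$ is the normal cone in $\widehat{\mathcal H}$ with its product inner product, and $N^{\widehat{\mathbf C}^{-1}}$ is the normal cone in $\widehat{\mathcal H}_{\mathbf{C}^{-1}}$. Problem of elasticity-monotone plasticity. $\widehat\Sigma\subset\widehat{\mathcal H}$ is a given closed convex nonempty set, possibly unbounded. Functions $\varepsilon,\varepsilon_{\rm el},\varepsilon_{\rm p},\sigma\in W^{1,\infty}(I,\mathcal{H})$, $\xi\in W^{1,\infty}(I,\mathcal{H}')$ solve the abstract problem of quasi-static evolution in elasticity-monotone plasticity if (EMP1) $\bm\varepsilon\in\mathrm{Im}\,\mathbf{E}+\bm g$; (EMP2) $\bm\varepsilon=\bm{\varepsilon_{\bf el}}+\bm{\varepsilon_{\bf p}}$; (EMP3) $\bm\sigma=\mathbf{C}\,\bm{\varepsilon_{\bf el}}$; (EMP4) $\frac{d}{dt}(\bm{\varepsilon_{\bf p}},-\bm\xi)\in N_{\widehat\Sigma}(\bm\sigma,\bm\xi)$ (in particular $(\bm\sigma,\bm\xi)\in\widehat\Sigma$);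 (EMP5) $\bm\sigma\in D(\mathbf{D})$ and $\mathbf{D}\bm\sigma=\bm f$; where (EMP1)–(EMP3), (EMP5) hold for all $t\in I$ and (EMP4) for a.a. $t\in I$, together with the initial condition $(\bm\varepsilon(0),\bm{\varepsilon_{\bf el}}(0),\bm{\varepsilon_{\bf p}}(0),\bm\sigma(0),\bm\xi(0))=(\bm\varepsilon_{\bf 0},\bm\varepsilon_{\bf el0},\bm\varepsilon_{\bf p0},\bm\sigma_{\bf 0},\bm\xi_{\bf 0})$, whose given right-hand side in $\mathcal{H}^4\times\mathcal{H}'$ satisfies (EMP1)–(EMP3), (EMP5) at $t=0$ and $(\bm\sigma_{\bf 0},\bm\xi_{\bf 0})\in\widehat\Sigma$. *)

theory Defs
  imports "HOL-Analysis.Analysis"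
begin

section \<open>Bochner--Sobolev functions on a compact interval\<close>

text \<open>
  A function in \<open>W\<^sup>1\<^sup>,\<^sup>\<infinity>([0,T], H)\<close> is identified with its continuous representative, i.e. with the
  indefinite Bochner integral of an essentially bounded, strongly measurable density.  For a
  separable \<open>H\<close> strong and Borel measurability agree.  Values outside \<open>[0,T]\<close> are irrelevant.
\<close>

definition is_weak_derivative ::
  "real \<Rightarrow> (real \<Rightarrow> 'a::{banach, second_countable_topology}) \<Rightarrow> (real \<Rightarrow> 'a) \<Rightarrow> bool" where
  "is_weak_derivative T h v \<longleftrightarrow>
     v \<in> borel_measurable (lebesgue_on {0..T}) \<and>
     (\<exists>M. AE t in lebesgue_on {0..T}. norm (v t) \<le> M) \<and>
     (\<forall>t\<in>{0..T}. h t = h 0 + integral\<^sup>L (lebesgue_on {0..t}) v)"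

definition W1inf :: "real \<Rightarrow> (real \<Rightarrow> 'a::{banach, second_countable_topology}) \<Rightarrow> bool" where
  "W1inf T h \<longleftrightarrow> (\<exists>v. is_weak_derivative T h v)"

text \<open>
  The density is unique up to null sets, so the choice below does not affect statements
  that hold for almost all times.
\<close>

definition ddt ::
  "real \<Rightarrow> (real \<Rightarrow> 'a::{banach, second_countable_topology}) \<Rightarrow> real \<Rightarrow> 'a" where
  "ddt T h = (SOME v. is_weak_derivative T h v)"


section \<open>Reflexivity and the dual of a subspace\<close>

definition reflexive_space :: "'x::real_normed_vector itself \<Rightarrow> bool" where
  "reflexive_space _ \<longleftrightarrow>
     (\<forall>\<Phi> :: ('x \<Rightarrow>\<^sub>L real) \<Rightarrow>\<^sub>L real. \<exists>x :: 'x. \<forall>\<phi>. blinfun_apply \<Phi> \<phi> = blinfun_apply \<phi> x)"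

text \<open>
  Elements of \<open>S\<^sup>*\<close> for a subspace \<open>S\<close> are represented by functions on the ambient type that vanish
  outside \<open>S\<close>, so that equality of representatives is equality in \<open>S\<^sup>*\<close>.
\<close>

definition subspace_dual :: "'x::real_normed_vector set \<Rightarrow> ('x \<Rightarrow> real) set" where
  "subspace_dual S =
     {\<phi>. (\<forall>x\<in>S. \<forall>y\<in>S. \<phi> (x + y) = \<phi> x + \<phi> y) \<and>
         (\<forall>a. \<forall>x\<in>S. \<phi> (a *\<^sub>R x) = a * \<phi> x) \<and>
         (\<exists>K. \<forall>x\<in>S. \<bar>\<phi> x\<bar> \<le> K * norm x) \<and>
         (\<forall>x. x \<notin> S \<longrightarrow> \<phi> x = 0)}"

definition dual_norm :: "'x::real_normed_vector set \<Rightarrow> ('x \<Rightarrow> real) \<Rightarrow> real" where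
  "dual_norm S \<phi> = (SUP x\<in>{x\<in>S. norm x \<le> 1}. \<bar>\<phi> x\<bar>)"

text \<open>
  The space \<open>W\<^sup>1\<^sup>,\<^sup>\<infinity>([0,T], Y)\<close> for a linear subspace \<open>Y\<close> of \<open>S\<^sup>*\<close> with the dual norm.  As \<open>S\<^sup>*\<close> need not
  be separable, strong measurability of the density \<open>v\<close> is required explicitly, through
  \<open>Y\<close>-valued simple functions converging to \<open>v\<close> in norm almost everywhere.  Together with essential
  boundedness this makes \<open>v\<close> Bochner integrable; evaluation at a point is a bounded functional on
  \<open>S\<^sup>*\<close>, so the value of the Bochner integral at \<open>x\<close> is the integral of \<open>\<lambda>r. v r x\<close>.
\<close>

definition W1inf_dual ::
  "real \<Rightarrow> 'x::real_normed_vector set \<Rightarrow> ('x \<Rightarrow> real) set \<Rightarrow> (real \<Rightarrow> 'x \<Rightarrow> real) \<Rightarrow> bool" where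
  "W1inf_dual T S Y f \<longleftrightarrow>
     (\<forall>t\<in>{0..T}. f t \<in> Y) \<and>
     (\<exists>v. (\<forall>t\<in>{0..T}. v t \<in> Y) \<and>
        (\<exists>s :: nat \<Rightarrow> real \<Rightarrow> 'x \<Rightarrow> real.
           (\<forall>n. simple_function (lebesgue_on {0..T}) (s n) \<and> (\<forall>t\<in>{0..T}. s n t \<in> Y)) \<and>
           (AE t in lebesgue_on {0..T}. (\<lambda>n. dual_norm S (\<lambda>x. s n t x - v t x)) \<longlonglongrightarrow> 0)) \<and>
        (\<exists>M. AE t in lebesgue_on {0..T}. dual_norm S (v t) \<le> M) \<and>
        (\<forall>t\<in>{0..T}. \<forall>x\<in>S. f t x = f 0 x + integral\<^sup>L (lebesgue_on {0..t}) (\<lambda>r. v r x)))"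


section \<open>The operators E and D\<close>

definition linear_operator_on ::
  "'x::real_vector set \<Rightarrow> ('x \<Rightarrow> 'h::real_vector) \<Rightarrow> bool" where
  "linear_operator_on W E \<longleftrightarrow>
     subspace W \<and>
     (\<forall>x\<in>W. \<forall>y\<in>W. E (x + y) = E x + E y) \<and>
     (\<forall>a. \<forall>x\<in>W. E (a *\<^sub>R x) = a *\<^sub>R E x)"

definition closed_operator_on ::
  "'x::topological_space set \<Rightarrow> ('x \<Rightarrow> 'h::topological_space) \<Rightarrow> bool" where
  "closed_operator_on W E \<longleftrightarrow> closed ((\<lambda>w. (w, E w)) ` W)"

text \<open>
  The adjoint of \<open>E\<close> regarded as a densely defined operator from \<open>closure W\<close> to \<open>H\<close>; since \<open>W\<close> is
  dense there, the functional in the following two definitions is unique.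
\<close>

definition adj_dom ::
  "'x::real_normed_vector set \<Rightarrow> ('x \<Rightarrow> 'h::real_inner) \<Rightarrow> 'h set" where
  "adj_dom W E = {\<sigma>. \<exists>\<phi>\<in>subspace_dual (closure W). \<forall>w\<in>W. \<phi> w = \<sigma> \<bullet> E w}"

definition adj ::
  "'x::real_normed_vector set \<Rightarrow> ('x \<Rightarrow> 'h::real_inner) \<Rightarrow> 'h \<Rightarrow> ('x \<Rightarrow> real)" where
  "adj W E \<sigma> = (THE \<phi>. \<phi> \<in> subspace_dual (closure W) \<and> (\<forall>w\<in>W. \<phi> w = \<sigma> \<bullet> E w))"

definition adj_im ::
  "'x::real_normed_vector set \<Rightarrow> ('x \<Rightarrow> 'h::real_inner) \<Rightarrow> ('x \<Rightarrow> real) set" where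
  "adj_im W E = adj W E ` adj_dom W E"

definition adj_ker ::
  "'x::real_normed_vector set \<Rightarrow> ('x \<Rightarrow> 'h::real_inner) \<Rightarrow> 'h set" where
  "adj_ker W E = {\<sigma> \<in> adj_dom W E. adj W E \<sigma> = (\<lambda>_. 0)}"


section \<open>Weighted inner products, projections, normal cones\<close>

definition symmetric_coercive :: "('h::real_inner \<Rightarrow> 'h) \<Rightarrow> bool" where
  "symmetric_coercive C \<longleftrightarrow>
     (\<forall>\<sigma> \<tau>. C \<sigma> \<bullet> \<tau> = \<sigma> \<bullet> C \<tau>) \<and> (\<exists>c0>0. \<forall>\<tau>. C \<tau> \<bullet> \<tau> \<ge> c0 * (norm \<tau>)\<^sup>2)"

definition winner :: "('h::real_inner \<Rightarrow> 'h) \<Rightarrow> 'h \<Rightarrow> 'h \<Rightarrow> real" where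
  "winner C \<sigma> \<tau> = \<sigma> \<bullet> inv C \<tau>"

definition winner_hat ::
  "('h::real_inner \<Rightarrow> 'h) \<Rightarrow> 'h \<times> 'k::real_inner \<Rightarrow> 'h \<times> 'k \<Rightarrow> real" where
  "winner_hat C p q = winner C (fst p) (fst q) + snd p \<bullet> snd q"

definition orth_proj ::
  "('a::real_vector \<Rightarrow> 'a \<Rightarrow> real) \<Rightarrow> 'a set \<Rightarrow> 'a \<Rightarrow> 'a" where
  "orth_proj ip V x = (THE v. v \<in> V \<and> (\<forall>w\<in>V. ip (x - v) w = 0))"

text \<open>
  The normal cone with respect to the inner product \<open>ip\<close>; it is empty at points outside the set, so
  membership in it entails that the base point belongs to the set.
\<close>

definition normal_cone ::
  "('a::real_vector \<Rightarrow> 'a \<Rightarrow> real) \<Rightarrow> 'a set \<Rightarrow> 'a \<Rightarrow> 'a set" where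
  "normal_cone ip A x = {z. x \<in> A \<and> (\<forall>c\<in>A. ip z (c - x) \<le> 0)}"


section \<open>The stress solution for elasticity\<close>

definition U_space :: "'x::real_normed_vector set \<Rightarrow> ('x \<Rightarrow> 'h::real_inner) \<Rightarrow> ('h \<Rightarrow> 'h) \<Rightarrow> 'h set" where
  "U_space W E C = (\<lambda>w. C (E w)) ` W"

definition G_op ::
  "'x::real_normed_vector set \<Rightarrow> ('x \<Rightarrow> 'h::real_inner) \<Rightarrow> ('h \<Rightarrow> 'h) \<Rightarrow> 'h \<Rightarrow> 'h" where
  "G_op W E C \<tau> = orth_proj (winner C) (adj_ker W E) (C \<tau>)"

definition Q_op ::
  "'x::real_normed_vector set \<Rightarrow> ('x \<Rightarrow> 'h::real_inner) \<Rightarrow> ('h \<Rightarrow> 'h) \<Rightarrow> ('x \<Rightarrow> real) \<Rightarrow> 'h" where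
  "Q_op W E C = the_inv_into (U_space W E C \<inter> adj_dom W E) (adj W E)"

definition elastic_stress ::
  "'x::real_normed_vector set \<Rightarrow> ('x \<Rightarrow> 'h::real_inner) \<Rightarrow> ('h \<Rightarrow> 'h) \<Rightarrow>
   (real \<Rightarrow> 'h) \<Rightarrow> (real \<Rightarrow> 'x \<Rightarrow> real) \<Rightarrow> real \<Rightarrow> 'h" where
  "elastic_stress W E C g f t = G_op W E C (g t) + Q_op W E C (f t)"


section \<open>Elasticity-monotone plasticity\<close>

text \<open>
  The relations that hold at every instant (all but the flow rule), for loads \<open>gt\<close>, \<open>ft\<close> at that
  instant: additive decomposition of a strain compatible with \<open>gt\<close>, Hooke's law, equilibrium.
\<close>

definition EMP_static ::
  "'x::real_normed_vector set \<Rightarrow> ('x \<Rightarrow> 'h::real_inner) \<Rightarrow> ('h \<Rightarrow> 'h) \<Rightarrow> 'h \<Rightarrow> ('x \<Rightarrow> real) \<Rightarrow>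
   'h \<Rightarrow> 'h \<Rightarrow> 'h \<Rightarrow> 'h \<Rightarrow> bool" where
  "EMP_static W E C gt ft e e_el e_p s \<longleftrightarrow>
     e \<in> (\<lambda>d. d + gt) ` (E ` W) \<and>
     e = e_el + e_p \<and>
     s = C e_el \<and>
     s \<in> adj_dom W E \<and> adj W E s = ft"

definition solves_EMP ::
  "real \<Rightarrow> 'x::real_normed_vector set \<Rightarrow>
   ('x \<Rightarrow> 'h::{real_inner, banach, second_countable_topology}) \<Rightarrow> ('h \<Rightarrow> 'h) \<Rightarrow>
   (real \<Rightarrow> 'h) \<Rightarrow> (real \<Rightarrow> 'x \<Rightarrow> real) \<Rightarrow>
   ('h \<times> 'k::{real_inner, banach, second_countable_topology}) set \<Rightarrow>
   'h \<times> 'h \<times> 'h \<times> 'h \<times> 'k \<Rightarrow>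
   (real \<Rightarrow> 'h) \<Rightarrow> (real \<Rightarrow> 'h) \<Rightarrow> (real \<Rightarrow> 'h) \<Rightarrow> (real \<Rightarrow> 'h) \<Rightarrow> (real \<Rightarrow> 'k) \<Rightarrow> bool" where
  "solves_EMP T W E C g f \<Sigma> init \<epsilon> \<epsilon>el \<epsilon>p \<sigma> \<xi> \<longleftrightarrow>
     W1inf T \<epsilon> \<and> W1inf T \<epsilon>el \<and> W1inf T \<epsilon>p \<and> W1inf T \<sigma> \<and> W1inf T \<xi> \<and>
     (\<forall>t\<in>{0..T}. EMP_static W E C (g t) (f t) (\<epsilon> t) (\<epsilon>el t) (\<epsilon>p t) (\<sigma> t)) \<and>
     (AE t in lebesgue_on {0..T}.
        ddt T (\<lambda>r. (\<epsilon>p r, - \<xi> r)) t \<in> normal_cone (\<bullet>) \<Sigma> (\<sigma> t, \<xi> t)) \<and>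
     (\<epsilon> 0, \<epsilon>el 0, \<epsilon>p 0, \<sigma> 0, \<xi> 0) = init"

definition shifted_set ::
  "('h::real_vector \<times> 'k::real_vector) set \<Rightarrow> 'h \<Rightarrow> ('h \<times> 'k) set" where
  "shifted_set \<Sigma> s = (\<lambda>p. p - (s, 0)) ` \<Sigma>"

definition moving_set ::
  "'x::real_normed_vector set \<Rightarrow> ('x \<Rightarrow> 'h::real_inner) \<Rightarrow>
   ('h \<times> 'k::real_vector) set \<Rightarrow> 'h \<Rightarrow> ('h \<times> 'k) set" where
  "moving_set W E \<Sigma> s = shifted_set \<Sigma> s \<inter> (adj_ker W E \<times> UNIV)"

end

(*
  Write PU for the projection onto U along V. Whenever the equilibrium equation D sigma = f holds,
  Q f = PU sigma, so the elastic stress is C g - PU (C g) + PU sigma. It therefore inherits its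
  regularity from sigma, without recourse to the boundedness of Q. Both sides of the equivalence force equilibrium at every time.
  Compatibility of the strain says that C epsilon - sigma~ takes values in the kernel of id - PU;
  given the initial condition this is equivalent to the same property of the weak derivative.
  Substituting Hooke's law, the flow rule together with C epsilon' - sigma~' in U is, pointwise in
  time, the inclusion for the strain rate. The sweeping process for (y, xi) follows from these two
  because U is orthogonal to V in the weighted product.
*)

theory Submission
  imports Defs
begin

section \<open>Weak derivatives\<close>

lemma weak_derivativeD:
  assumes "is_weak_derivative T h v"
  shows weak_derivative_measurable: "v \<in> borel_measurable (lebesgue_on {0..T})"
    and weak_derivative_bounded: "\<exists>M. AE t in lebesgue_on {0..T}. norm (v t) \<le> M"
    and weak_derivative_eq: "t \<in> {0..T} \<Longrightarrow> h t = h 0 + integral\<^sup>L (lebesgue_on {0..t}) v"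
  using assms unfolding is_weak_derivative_def by blast+

lemma weak_derivative_integrable:
  assumes "is_weak_derivative T h v"
  shows "integrable (lebesgue_on {0..T}) v"
proof -
  interpret finite_measure "lebesgue_on {0..T}"
    by (rule finite_measure_lebesgue_on) auto
  show ?thesis
    using weak_derivativeD(1,2)[OF assms] by (auto intro: integrable_const_bound)
qed

lemma lebesgue_on_initial_segment:
  fixes t T :: real
  assumes "t \<in> {0..T}"
  shows "lebesgue_on {0..t} = restrict_space (lebesgue_on {0..T}) {0..t}"
proof -
  have "{0..T} \<inter> {0..t} = {0..t}" using assms by auto
  then show ?thesis by (subst restrict_restrict_space) (simp_all del: Int_atLeastAtMost)
qed

lemma integral_initial_segment:
  fixes v :: "real \<Rightarrow> 'a::{banach, second_countable_topology}"
  assumes "t \<in> {0..T}"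
  shows "integral\<^sup>L (lebesgue_on {0..t}) v = (LINT r:{0..t}|lebesgue_on {0..T}. v r)"
  unfolding lebesgue_on_initial_segment[OF assms] set_lebesgue_integral_def
  using assms by (subst integral_restrict_space) (auto simp: sets_restrict_space)

lemma integrable_initial_segment:
  fixes v :: "real \<Rightarrow> 'a::{banach, second_countable_topology}"
  assumes "integrable (lebesgue_on {0..T}) v" "t \<in> {0..T}"
  shows "integrable (lebesgue_on {0..t}) v"
proof -
  have "{0..t} \<in> sets (lebesgue_on {0..T})"
    using assms(2) by (auto simp: sets_restrict_space)
  then show ?thesis
    unfolding lebesgue_on_initial_segment[OF assms(2)]
    using assms(2) sets.top[of "lebesgue_on {0..T}"]
    by (subst integrable_restrict_space) (auto intro!: integrable_mult_indicator assms(1))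
qed

text \<open>Half-lines form an intersection-stable generator of the Borel sets, so a Dynkin argument
  carries the vanishing of the integral from initial segments to all Borel sets. Completion extends
  it to Lebesgue sets, and an integrable function whose integral over every measurable set is zero
  vanishes almost everywhere.\<close>

lemma AE_zero_if_initial_integrals_zero:
  fixes w :: "real \<Rightarrow> 'a::{banach, second_countable_topology}"
  assumes int: "integrable (lebesgue_on {0..T}) w"
    and zero: "\<And>t. t \<in> {0..T} \<Longrightarrow> integral\<^sup>L (lebesgue_on {0..t}) w = 0"
  shows "AE t in lebesgue_on {0..T}. w t = 0"
proof (rule sigma_finite_measure.density_zero[OF _ int])
  let ?M = "lebesgue_on {0..T}"
  interpret finite_measure ?M by (rule finite_measure_lebesgue_on) auto
  show "sigma_finite_measure ?M" by unfold_locales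
  have sint: "set_integrable ?M A w" if "A \<in> sets ?M" for A
    unfolding set_integrable_def using that int by (rule integrable_mult_indicator)
  \<comment> \<open>For \<open>T < 0\<close> the measure space is empty, so no sign condition on
    \<open>T\<close> enters here.\<close>
  have total: "integral\<^sup>L ?M w = 0"
    using zero[of T] by (cases "T \<ge> 0") (auto intro: integral_empty simp: space_restrict_space)
  have borel_meas: "B \<inter> {0..T} \<in> sets ?M" if "B \<in> sets borel" for B
    using that by (auto simp: sets_restrict_space)
  have inter: "(LINT r:B|?M. w r) = (LINT r:B \<inter> {0..T}|?M. w r)" for B
    unfolding set_lebesgue_integral_def
    by (rule Bochner_Integration.integral_cong) (auto simp: space_restrict_space indicator_def)
  have borel0: "(LINT r:B|?M. w r) = 0" if "B \<in> sets borel" for B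
  proof -
    have B: "B \<in> sigma_sets UNIV (range (\<lambda>a::real. {..a}))"
      using that by (simp add: borel_eq_atMost)
    have sig: "sigma_sets UNIV (range (\<lambda>a::real. {..a})) = sets borel"
      by (simp add: borel_eq_atMost)
    have "Int_stable (range (\<lambda>a::real. {..a}))" "range (\<lambda>a::real. {..a}) \<subseteq> Pow UNIV"
      by (auto simp: Int_stable_def)
    then show ?thesis
      using B
    proof (induction rule: sigma_sets_induct_disjoint)
      case (basic A)
      then obtain a where A: "A = {..a}" by auto
      \<comment> \<open>Within the interval a half-line becomes empty, everything, or an initial
        segment.\<close>
      consider "a < 0" | "T < a" | "a \<in> {0..T}" by fastforce
      then show ?case
      proof cases
        case 1
        then have "A \<inter> {0..T} = {}" by (auto simp: A)
        then show ?thesis by (subst inter) (simp add: set_lebesgue_integral_def)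
      next
        case 2
        then have "A \<inter> {0..T} = {0..T}" by (auto simp: A)
        then show ?thesis
          using total set_integral_space[OF int] by (subst inter) (simp add: space_restrict_space)
      next
        case 3
        then have "A \<inter> {0..T} = {0..a}" by (auto simp: A)
        then show ?thesis
          using zero[OF 3] integral_initial_segment[OF 3, of w] by (subst inter) simp
      qed
    next
      case empty
      then show ?case by (simp add: set_lebesgue_integral_def)
    next
      case (compl A)
      then have A: "A \<in> sets borel" by (simp add: sig)
      have "(LINT r:{0..T}|?M. w r) = (LINT r:A \<inter> {0..T}|?M. w r) + (LINT r:(UNIV - A) \<inter> {0..T}|?M. w r)"
      proof -
        have "{0..T} = A \<inter> {0..T} \<union> (UNIV - A) \<inter> {0..T}" by blast
        moreover have "(LINT r:A \<inter> {0..T} \<union> (UNIV - A) \<inter> {0..T}|?M. w r) =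
            (LINT r:A \<inter> {0..T}|?M. w r) + (LINT r:(UNIV - A) \<inter> {0..T}|?M. w r)"
          using A by (intro set_integral_Un sint borel_meas) auto
        ultimately show ?thesis by metis
      qed
      then show ?case
        using total set_integral_space[OF int] compl inter[of A] inter[of "UNIV - A"]
        by (simp add: space_restrict_space)
    next
      case (union A)
      have A: "A i \<in> sets borel" for i using union by (auto simp: sig)
      have "(LINT r:(\<Union>i. A i \<inter> {0..T})|?M. w r) = (\<Sum>i. (LINT r:A i \<inter> {0..T}|?M. w r))"
      proof (rule lebesgue_integral_countable_add)
        show "A i \<inter> {0..T} \<in> sets ?M" for i using A by (rule borel_meas)
        show "i \<noteq> j \<Longrightarrow> A i \<inter> {0..T} \<inter> (A j \<inter> {0..T}) = {}" for i j
          using union(1) by (auto simp: disjoint_family_on_def)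
        show "set_integrable ?M (\<Union>i. A i \<inter> {0..T}) w"
          by (intro sint sets.countable_UN) (auto intro: borel_meas A)
      qed
      then show ?case
        using union(3) inter[of "\<Union>i. A i"] inter[of "A _"] by simp
    qed
  qed
  show "(LINT r:A|?M. w r) = 0" if A: "A \<in> sets ?M" for A
  proof -
    have "A \<in> sets lebesgue"
      using A by (auto simp: sets_restrict_space)
    \<comment> \<open>A Lebesgue set is a Borel set \<open>S\<close> together with a subset of a
      Borel null set \<open>N'\<close>; off \<open>N'\<close> the two indicators agree.\<close>
    then obtain S N N' where A': "A = S \<union> N" "N \<subseteq> N'" "N' \<in> null_sets lborel" "S \<in> sets lborel"
      by (rule sets_completionE)
    have "AE x in lborel. x \<notin> N'" using A'(3) by (rule AE_not_in)
    then have "AE x in lebesgue. x \<notin> N'" by (rule AE_completion)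
    then have "AE x in lebesgue. x \<in> {0..T} \<longrightarrow> x \<notin> N'" by eventually_elim simp
    then have "AE x in ?M. x \<notin> N'" by (subst AE_restrict_space_iff) simp_all
    then have "AE x in ?M. indicat_real A x *\<^sub>R w x = indicat_real (S \<inter> {0..T}) x *\<^sub>R w x"
      using AE_space
      by eventually_elim (use A' in \<open>auto simp: indicator_def space_restrict_space\<close>)
    moreover have "S \<in> sets borel" using A'(4) by simp
    ultimately have "(LINT r:A|?M. w r) = (LINT r:S \<inter> {0..T}|?M. w r)"
      unfolding set_lebesgue_integral_def using sint[OF A] sint[OF borel_meas, of S]
      by (intro integral_cong_AE) (simp_all add: set_integrable_def borel_measurable_integrable)
    then show ?thesis using borel0 \<open>S \<in> sets borel\<close> inter[of S] by simp
  qed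
qed

lemma weak_derivative_unique:
  assumes v: "is_weak_derivative T h v" and w: "is_weak_derivative T k w"
    and eq: "\<And>t. t \<in> {0..T} \<Longrightarrow> h t = k t"
  shows "AE t in lebesgue_on {0..T}. v t = w t"
proof -
  note int = weak_derivative_integrable[OF v] weak_derivative_integrable[OF w]
  have "AE t in lebesgue_on {0..T}. v t - w t = 0"
  proof (rule AE_zero_if_initial_integrals_zero)
    show "integral\<^sup>L (lebesgue_on {0..t}) (\<lambda>r. v r - w r) = 0" if t: "t \<in> {0..T}" for t
    proof -
      have "h t = h 0 + integral\<^sup>L (lebesgue_on {0..t}) v" "k t = k 0 + integral\<^sup>L (lebesgue_on {0..t}) w"
        using t by (rule weak_derivative_eq[OF v], rule weak_derivative_eq[OF w])
      moreover have "h t = k t" "h 0 = k 0" using eq t by auto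
      ultimately show ?thesis
        using int[THEN integrable_initial_segment[OF _ t]] by simp
    qed
  qed (use int in auto)
  then show ?thesis by simp
qed

section \<open>Calculus of weak derivatives\<close>

lemma weak_derivative_cong:
  assumes "is_weak_derivative T h v" "\<And>t. t \<in> {0..T} \<Longrightarrow> k t = h t"
  shows "is_weak_derivative T k v"
proof -
  have "k t = k 0 + integral\<^sup>L (lebesgue_on {0..t}) v" if "t \<in> {0..T}" for t
    using weak_derivative_eq[OF assms(1) that] assms(2)[of t] assms(2)[of 0] that by simp
  then show ?thesis using assms(1) unfolding is_weak_derivative_def by blast
qed

lemma weak_derivative_ddt:
  assumes "W1inf T h"
  shows "is_weak_derivative T h (ddt T h)"
  using assms unfolding W1inf_def ddt_def by (rule someI_ex)

text \<open>This removes the arbitrary choice inside \<open>ddt\<close>: any density computed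
  explicitly may stand in for it almost everywhere.\<close>

lemma ddt_AE_eq:
  assumes "is_weak_derivative T h v"
  shows "AE t in lebesgue_on {0..T}. ddt T h t = v t"
  using weak_derivative_ddt[of T h] assms by (intro weak_derivative_unique) (auto simp: W1inf_def)

lemma weak_derivative_bounded_linear:
  assumes L: "bounded_linear L" and v: "is_weak_derivative T h v"
  shows "is_weak_derivative T (\<lambda>t. L (h t)) (\<lambda>t. L (v t))"
proof -
  interpret L: bounded_linear L by fact
  have "L \<in> borel_measurable borel"
    by (intro borel_measurable_continuous_onI L.continuous_on continuous_on_id)
  then have "(\<lambda>t. L (v t)) \<in> borel_measurable (lebesgue_on {0..T})"
    using weak_derivative_measurable[OF v] by (rule measurable_compose[rotated])
  moreover obtain M where M: "AE t in lebesgue_on {0..T}. norm (v t) \<le> M"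
    using weak_derivative_bounded[OF v] by blast
  obtain K where K: "K \<ge> 0" "norm (L x) \<le> norm x * K" for x using L.nonneg_bounded by blast
  have "AE t in lebesgue_on {0..T}. norm (L (v t)) \<le> M * K"
    using M by eventually_elim (use K mult_right_mono order_trans in blast)
  moreover have "L (h t) = L (h 0) + integral\<^sup>L (lebesgue_on {0..t}) (\<lambda>t. L (v t))"
    if "t \<in> {0..T}" for t
    using weak_derivative_eq[OF v that] L.add
      integral_bounded_linear[OF L integrable_initial_segment[OF weak_derivative_integrable[OF v] that]]
    by metis
  ultimately show ?thesis unfolding is_weak_derivative_def by blast
qed

lemma weak_derivative_add:
  assumes v: "is_weak_derivative T h v" and w: "is_weak_derivative T k w"
  shows "is_weak_derivative T (\<lambda>t. h t + k t) (\<lambda>t. v t + w t)"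
proof -
  obtain M N where "AE t in lebesgue_on {0..T}. norm (v t) \<le> M" "AE t in lebesgue_on {0..T}. norm (w t) \<le> N"
    using weak_derivative_bounded[OF v] weak_derivative_bounded[OF w] by blast
  then have "AE t in lebesgue_on {0..T}. norm (v t + w t) \<le> M + N"
    by eventually_elim (rule norm_triangle_mono)
  moreover have "h t + k t = h 0 + k 0 + integral\<^sup>L (lebesgue_on {0..t}) (\<lambda>t. v t + w t)"
    if t: "t \<in> {0..T}" for t
    using weak_derivative_eq[OF v t] weak_derivative_eq[OF w t]
      integrable_initial_segment[OF weak_derivative_integrable[OF v] t]
      integrable_initial_segment[OF weak_derivative_integrable[OF w] t]
    by (simp add: add.assoc add.left_commute)
  moreover have "(\<lambda>t. v t + w t) \<in> borel_measurable (lebesgue_on {0..T})"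
    using weak_derivative_measurable[OF v] weak_derivative_measurable[OF w]
    by (rule borel_measurable_add)
  ultimately show ?thesis
    unfolding is_weak_derivative_def by blast
qed

lemma weak_derivative_diff:
  assumes "is_weak_derivative T h v" "is_weak_derivative T k w"
  shows "is_weak_derivative T (\<lambda>t. h t - k t) (\<lambda>t. v t - w t)"
  using weak_derivative_add[OF assms(1)
      weak_derivative_bounded_linear[OF bounded_linear_minus[OF bounded_linear_ident] assms(2)]]
  by simp

lemma weak_derivative_Pair:
  assumes "is_weak_derivative T h v" "is_weak_derivative T k w"
  shows "is_weak_derivative T (\<lambda>t. (h t, k t)) (\<lambda>t. (v t, w t))"
proof -
  \<comment> \<open>A pair is the sum of its two coordinate embeddings, so the rules for linear maps
    and sums suffice.\<close>
  have "bounded_linear (\<lambda>x::'a. (x, 0::'b))" "bounded_linear (\<lambda>x::'b. (0::'a, x))"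
    by (intro bounded_linear_Pair bounded_linear_ident bounded_linear_zero)+
  then show ?thesis
    using weak_derivative_add[OF weak_derivative_bounded_linear weak_derivative_bounded_linear]
      assms by fastforce
qed

section \<open>From almost every time to every time\<close>

text \<open>An essential bound on the density is a Lipschitz constant, because increments are
  integrals of the density over half-open intervals.\<close>

lemma weak_derivative_continuous:
  assumes v: "is_weak_derivative T h v"
  shows "continuous_on {0..T} h"
proof -
  let ?M = "lebesgue_on {0..T}"
  obtain M where "AE t in ?M. norm (v t) \<le> M"
    using weak_derivative_bounded[OF v] by blast
  note int = weak_derivative_integrable[OF v]
  have seg: "set_integrable ?M {s..t} v" if "0 \<le> s" "t \<le> T" for s t
    unfolding set_integrable_def using that
    by (intro integrable_mult_indicator int) (auto simp: sets_restrict_space)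
  \<comment> \<open>The essential bound \<open>M\<close> may be negative if the interval is null; a
    Lipschitz constant may not.\<close>
  define M' where "M' = max M 0"
  have M': "AE t in ?M. norm (v t) \<le> M'" "M' \<ge> 0"
    using \<open>AE t in ?M. norm (v t) \<le> M\<close> by (auto simp: M'_def)
  have lip: "norm (h t - h s) \<le> M' * (t - s)" if st: "0 \<le> s" "s \<le> t" "t \<le> T" for s t
  proof -
    have "s \<in> {0..T}" "t \<in> {0..T}" using st by auto
    then have "h t - h s = (LINT r:{0..t}|?M. v r) - (LINT r:{0..s}|?M. v r)"
      using weak_derivative_eq[OF v, of t] weak_derivative_eq[OF v, of s]
        integral_initial_segment[of t T v] integral_initial_segment[of s T v] by simp
    also have "(LINT r:{0..t}|?M. v r) = (LINT r:{0..s}|?M. v r) + (LINT r:{s<..t}|?M. v r)"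
    proof -
      have "{s<..t} \<in> sets ?M" using st by (auto simp: sets_restrict_space)
      then have "set_integrable ?M {s<..t} v"
        unfolding set_integrable_def by (intro integrable_mult_indicator int)
      then have "(LINT r:{0..s} \<union> {s<..t}|?M. v r) = (LINT r:{0..s}|?M. v r) + (LINT r:{s<..t}|?M. v r)"
        using seg st by (intro set_integral_Un) auto
      moreover have "{0..s} \<union> {s<..t} = {0..t}" using st by auto
      ultimately show ?thesis by simp
    qed
    finally have "norm (h t - h s) = norm (LINT r|?M. indicat_real {s<..t} r *\<^sub>R v r)"
      by (simp add: set_lebesgue_integral_def)
    also have "\<dots> \<le> (LINT r|?M. norm (indicat_real {s<..t} r *\<^sub>R v r))"
      by (rule integral_norm_bound)
    also have "\<dots> \<le> (LINT r|?M. indicat_real {s<..t} r * M')"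
    proof (rule integral_mono_AE)
      have meas: "{s<..t} \<in> sets ?M" using st by (auto simp: sets_restrict_space)
      show "integrable ?M (\<lambda>r. norm (indicat_real {s<..t} r *\<^sub>R v r))"
        by (intro integrable_norm integrable_mult_indicator int meas)
      have "emeasure ?M {s<..t} = emeasure lebesgue {s<..t}"
        using st by (intro emeasure_restrict_space) auto
      then show "integrable ?M (\<lambda>r. indicat_real {s<..t} r * M')"
        using meas st by (intro integrable_mult_left integrable_real_indicator) auto
      show "AE r in ?M. norm (indicat_real {s<..t} r *\<^sub>R v r) \<le> indicat_real {s<..t} r * M'"
        using M'(1) by eventually_elim (auto simp: indicator_def)
    qed
    also have "\<dots> = measure ?M {s<..t} * M'"
      using st by (simp add: space_restrict_space Int_absorb2 subset_eq)
    also have "measure ?M {s<..t} = t - s"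
      using st by (subst measure_restrict_space) auto
    finally show ?thesis by (simp add: mult.commute)
  qed
  have "M'-lipschitz_on {0..T} h"
  proof (rule lipschitz_onI)
    fix s t assume "s \<in> {0..T}" "t \<in> {0..T}"
    then show "dist (h s) (h t) \<le> M' * dist s t"
      using lip[of s t] lip[of t s]
      by (cases "s \<le> t") (auto simp: dist_norm norm_minus_commute)
  qed (rule M'(2))
  then show ?thesis by (rule lipschitz_on_continuous_on)
qed

text \<open>By continuity a single violation persists on a relatively open neighbourhood, and since
  \<open>T > 0\<close> this contains an interval of positive measure, even around an
  endpoint.\<close>

lemma AE_closed_imp_all:
  fixes h :: "real \<Rightarrow> 'a::topological_space"
  assumes "T > 0" and cont: "continuous_on {0..T} h" and S: "closed S"
    and AE: "AE t in lebesgue_on {0..T}. h t \<in> S" and t: "t \<in> {0..T}"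
  shows "h t \<in> S"
proof (rule ccontr)
  assume "h t \<notin> S"
  have "openin (top_of_set {0..T}) ({0..T} \<inter> h -` (- S))"
    using cont S by (intro continuous_openin_preimage_gen) auto
  then obtain d where d: "d > 0" "\<And>s. s \<in> {0..T} \<Longrightarrow> dist s t < d \<Longrightarrow> h s \<notin> S"
    using t \<open>h t \<notin> S\<close> unfolding openin_euclidean_subtopology_iff by blast
  \<comment> \<open>The interval of radius \<open>d\<close> around \<open>t\<close>, clipped to the
    time interval.\<close>
  define a b where "a = max 0 (t - d)" and "b = min T (t + d)"
  have ab: "a < b" using d t \<open>T > 0\<close> by (auto simp: a_def b_def)
  have "AE s in lebesgue. s \<in> {0..T} \<longrightarrow> h s \<in> S"
    using AE by (subst (asm) AE_restrict_space_iff) auto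
  then have "AE s in lebesgue. s \<notin> {a<..<b}"
    by eventually_elim (use d(2) in \<open>auto simp: a_def b_def dist_real_def\<close>)
  then have "{a<..<b} \<in> null_sets lebesgue" by (subst AE_iff_null_sets) auto
  then show False using ab by auto
qed

text \<open>Applying \<open>L\<close> to \<open>h\<close> applies it to the density as well, so one
  direction is uniqueness of the density of the zero function and the other is integration from a
  zero initial value. With a projection defect as \<open>L\<close>, membership in a closed subspace
  passes between a function and its derivative.\<close>

lemma weak_derivative_in_kernel_iff:
  fixes L :: "'a::{banach, second_countable_topology} \<Rightarrow> 'b::{banach, second_countable_topology}"
  assumes L: "bounded_linear L" and v: "is_weak_derivative T h v"
    and "L (h 0) = 0"
  shows "(AE t in lebesgue_on {0..T}. L (v t) = 0) \<longleftrightarrow> (\<forall>t\<in>{0..T}. L (h t) = 0)"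
proof -
  note d = weak_derivative_bounded_linear[OF L v]
  have zero: "is_weak_derivative T (\<lambda>_. 0) (\<lambda>_. 0)"
    by (auto simp: is_weak_derivative_def)
  show ?thesis
  proof
    assume *: "\<forall>t\<in>{0..T}. L (h t) = 0"
    show "AE t in lebesgue_on {0..T}. L (v t) = 0"
      by (rule weak_derivative_unique[OF d zero]) (use * in auto)
  next
    assume *: "AE t in lebesgue_on {0..T}. L (v t) = 0"
    show "\<forall>t\<in>{0..T}. L (h t) = 0"
    proof
      fix t assume t: "t \<in> {0..T}"
      have "AE r in lebesgue_on {0..t}. L (v r) = 0"
      proof -
        have "AE r in lebesgue. r \<in> {0..T} \<longrightarrow> L (v r) = 0"
          using * by (subst (asm) AE_restrict_space_iff) auto
        then have "AE r in lebesgue. r \<in> {0..t} \<longrightarrow> L (v r) = 0"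
          by eventually_elim (use t in auto)
        then show ?thesis by (subst AE_restrict_space_iff) auto
      qed
      then have "integral\<^sup>L (lebesgue_on {0..t}) (\<lambda>t. L (v t)) = 0"
        by (rule integral_eq_zero_AE)
      then show "L (h t) = 0"
        using weak_derivative_eq[OF d t] assms(3) by simp
    qed
  qed
qed

section \<open>The operators of elasticity\<close>

text \<open>The solution minimises the energy \<open>A e \<bullet> e - 2 (x \<bullet> e)\<close> over \<open>S\<close>; minimising sequences are Cauchy by the
  parallelogram identity.\<close>

lemma coercive_galerkin_solution:
  fixes A :: "'h::{real_inner, banach} \<Rightarrow> 'h"
  assumes A: "bounded_linear A" and sym: "\<And>u v. A u \<bullet> v = u \<bullet> A v"
    and c: "c > 0" "\<And>u. A u \<bullet> u \<ge> c * (norm u)\<^sup>2"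
    and S: "subspace S" "closed S"
  shows "\<exists>e\<in>S. \<forall>w\<in>S. (x - A e) \<bullet> w = 0"
proof -
  interpret A: bounded_linear A by fact
  define J where "J = (\<lambda>e. A e \<bullet> e - 2 * (x \<bullet> e))"
  have J_lower: "J e \<ge> - (norm x)\<^sup>2 / c" for e
  proof -
    \<comment> \<open>Completing the square after multiplication by \<open>c\<close> bounds the
      energy from below.\<close>
    have "0 \<le> (c * norm e - norm x)\<^sup>2" by simp
    then have "- (norm x)\<^sup>2 \<le> c * (c * (norm e)\<^sup>2 - 2 * (norm x * norm e))"
      by (simp add: power2_eq_square algebra_simps)
    then have "- (norm x)\<^sup>2 / c \<le> c * (norm e)\<^sup>2 - 2 * (norm x * norm e)"
      using c(1) by (subst pos_divide_le_eq) (simp_all add: mult.commute)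
    also have "\<dots> \<le> J e"
      using c(2)[of e] norm_cauchy_schwarz[of x e] by (simp add: J_def)
    finally show ?thesis .
  qed
  then have bdd: "bdd_below (J ` S)" by (auto intro!: bdd_belowI2[where m = "- (norm x)\<^sup>2 / c"])
  define m where "m = (INF e\<in>S. J e)"
  have m: "m \<le> J e" if "e \<in> S" for e
    unfolding m_def using bdd that by (rule cINF_lower)
  have "\<exists>e\<in>S. J e < m + 1 / real (Suc n)" for n
    unfolding m_def using S(1) bdd
    by (subst cINF_less_iff[symmetric]) (auto dest: subspace_0)
  then obtain e where e: "\<And>n. e n \<in> S" "\<And>n. J (e n) < m + 1 / real (Suc n)" by metis
  \<comment> \<open>Parallelogram identity for the quadratic part of \<open>J\<close>; the linear
    part is averaged exactly. As \<open>m\<close> bounds the energy of the midpoint from below, two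
    nearly minimal points must be close.\<close>
  have mid: "J ((1/2) *\<^sub>R (a + b)) = (J a + J b) / 2 - A (a - b) \<bullet> (a - b) / 4" for a b
    unfolding J_def by (simp add: A.add A.diff A.scaleR inner_simps sym inner_commute[of b "A a"] field_simps)
  have close: "c * (norm (e i - e j))\<^sup>2 \<le> 2 / real (Suc i) + 2 / real (Suc j)" for i j
  proof -
    have "m \<le> J ((1/2) *\<^sub>R (e i + e j))"
      using S(1) e(1) by (intro m) (auto intro: subspace_scale subspace_add)
    then have "c * (norm (e i - e j))\<^sup>2 \<le> 2 * (J (e i) - m) + 2 * (J (e j) - m)"
    proof -
      have "m \<le> q \<Longrightarrow> q = (a + b) / 2 - r / 4 \<Longrightarrow> s \<le> r \<Longrightarrow> s \<le> 2 * (a - m) + 2 * (b - m)"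
        for q r s a b :: real by (simp add: field_simps)
      from this[OF _ mid c(2)] show ?thesis using \<open>m \<le> _\<close> by blast
    qed
    also have "\<dots> \<le> 2 / real (Suc i) + 2 / real (Suc j)"
      using e(2)[of i] e(2)[of j] by simp
    finally show ?thesis .
  qed
  have "Cauchy e"
  proof (rule CauchyI)
    fix \<delta> :: real assume \<delta>: "\<delta> > 0"
    \<comment> \<open>From index \<open>N\<close> on, the bound in \<open>close\<close> is at most 4
      / (N + 1), which has to fall below \<open>c * \<delta>\<^sup>2\<close>.\<close>
    obtain N where N: "4 / (c * \<delta>\<^sup>2) < real (Suc N)"
      using reals_Archimedean2[of "4 / (c * \<delta>\<^sup>2)"] by (metis less_Suc_eq of_nat_less_iff order.strict_trans)
    have "norm (e i - e j) < \<delta>" if "i \<ge> N" "j \<ge> N" for i j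
    proof -
      have "c * (norm (e i - e j))\<^sup>2 \<le> 2 / real (Suc i) + 2 / real (Suc j)" by (rule close)
      also have "\<dots> \<le> 2 / real (Suc N) + 2 / real (Suc N)"
        using that by (intro add_mono divide_left_mono) auto
      also have "\<dots> = 4 / real (Suc N)" by simp
      also have "\<dots> < c * \<delta>\<^sup>2"
        using N c(1) \<delta> by (simp add: divide_less_eq mult.commute del: of_nat_Suc)
      finally have "(norm (e i - e j))\<^sup>2 < \<delta>\<^sup>2" using c(1) by simp
      then show ?thesis using \<delta> by (simp add: power_less_imp_less_base)
    qed
    then show "\<exists>M. \<forall>m\<ge>M. \<forall>n\<ge>M. norm (e m - e n) < \<delta>" by blast
  qed
  then obtain l where l: "e \<longlonglongrightarrow> l" by (auto simp: Cauchy_convergent_iff convergent_def)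
  then have lS: "l \<in> S" using S(2) e(1) closed_sequentially by blast
  have "(\<lambda>n. J (e n)) \<longlonglongrightarrow> J l"
    unfolding J_def using l by (intro tendsto_intros A.tendsto)
  moreover have "(\<lambda>n. m + 1 / real (Suc n)) \<longlonglongrightarrow> m + 0"
    by (intro tendsto_add tendsto_const LIMSEQ_Suc lim_1_over_n)
  ultimately have "J l \<le> m + 0"
    by (rule LIMSEQ_le) (use e(2) in \<open>auto intro: less_imp_le\<close>)
  have "(x - A l) \<bullet> w = 0" if w: "w \<in> S" for w
  proof -
    define p where "p = (x - A l) \<bullet> w"
    define q where "q = A w \<bullet> w"
    have "q \<ge> 0" using c(2)[of w] c(1) by (simp add: q_def order_trans[OF _ c(2)])
    have "0 \<le> t\<^sup>2 * q - 2 * t * p" for t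
    proof -
      have "J l \<le> J (l + t *\<^sub>R w)"
        using \<open>J l \<le> m + 0\<close> m[OF subspace_add[OF S(1) lS subspace_scale[OF S(1) w, of t]]] by linarith
      also have "\<dots> = J l + (t\<^sup>2 * q - 2 * t * p)"
        unfolding J_def p_def q_def
        by (simp add: A.add A.diff A.scaleR inner_simps sym inner_commute[of w "A l"] power2_eq_square algebra_simps)
      finally show ?thesis by simp
    qed
    \<comment> \<open>The optimal step would be \<open>p / q\<close>; enlarging the denominator to
      \<open>q + 1\<close> avoids the case \<open>q = 0\<close>. The expression then equals minus
      the square of the step times \<open>q + 2\<close>, which forces \<open>p = 0\<close>.\<close>
    then have "0 \<le> (p / (q + 1))\<^sup>2 * q - 2 * (p / (q + 1)) * p" .
    moreover have "p = (p / (q + 1)) * (q + 1)" using \<open>q \<ge> 0\<close> by simp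
    ultimately have "(p / (q + 1))\<^sup>2 * (q + 2) \<le> 0"
      by (smt (verit) power2_eq_square mult.assoc mult.commute distrib_left)
    then have "p = 0" using \<open>q \<ge> 0\<close> by (auto simp: mult_le_0_iff)
    then show ?thesis by (simp add: p_def)
  qed
  then show ?thesis using lS by blast
qed

section \<open>The elasticity operator and its inverse\<close>

locale elastic_operators =
  fixes W :: "'x::real_normed_vector set" and E :: "'x \<Rightarrow> 'h::{real_inner, banach}" and C :: "'h \<Rightarrow> 'h"
  assumes lin_E: "linear_operator_on W E" and closed_im: "closed (E ` W)"
    and C: "bounded_linear C" and sc: "symmetric_coercive C"
begin

sublocale C: bounded_linear C by (rule C)

lemma C_sym: "C u \<bullet> v = u \<bullet> C v"
  using sc by (simp add: symmetric_coercive_def)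

lemma C_coercive:
  obtains c where "c > 0" "\<And>u. c * (norm u)\<^sup>2 \<le> C u \<bullet> u"
  using sc by (auto simp: symmetric_coercive_def)

lemma C_inner_self_zero: "C u \<bullet> u = 0 \<Longrightarrow> u = 0"
  by (metis C_coercive mult_le_0_iff norm_eq_zero norm_ge_zero not_less power2_eq_square
      power2_less_eq_zero_iff)

lemma subspace_im: "subspace (E ` W)"
proof (rule subspaceI)
  have "0 \<in> W" using lin_E unfolding linear_operator_on_def by (auto intro: subspace_0)
  moreover from this have "E (0 *\<^sub>R 0) = 0 *\<^sub>R E 0"
    using lin_E unfolding linear_operator_on_def by blast
  ultimately show "0 \<in> E ` W" by (metis imageI scaleR_zero_left)
next
  fix x y assume "x \<in> E ` W" "y \<in> E ` W"
  then obtain a b where "a \<in> W" "b \<in> W" "x = E a" "y = E b" by auto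
  then show "x + y \<in> E ` W"
    using lin_E unfolding linear_operator_on_def by (metis imageI subspace_add)
next
  fix c x assume "x \<in> E ` W"
  then obtain a where "a \<in> W" "x = E a" by auto
  then show "c *\<^sub>R x \<in> E ` W"
    using lin_E unfolding linear_operator_on_def by (metis imageI subspace_scale)
qed

text \<open>Two instances matter: the whole space, which gives surjectivity of \<open>C\<close> as
  in Lax-Milgram, and the closed image of \<open>E\<close>, which splits the space into U and
  V.\<close>

lemma galerkin: "subspace S \<Longrightarrow> closed S \<Longrightarrow> \<exists>e\<in>S. \<forall>w\<in>S. (x - C e) \<bullet> w = 0"
  by (rule C_coercive) (rule coercive_galerkin_solution[OF C C_sym])

lemma bij_C: "bij C"
proof (rule bijI)
  show "inj C"
    by (rule injI) (metis C.diff C_inner_self_zero diff_self eq_iff_diff_eq_0 inner_zero_left)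
  show "surj C"
  proof -
    have "\<exists>e. x = C e" for x
    proof -
      obtain e where "\<forall>w. (x - C e) \<bullet> w = 0" using galerkin[of UNIV x] by auto
      then have "x - C e = 0" using inner_eq_zero_iff by blast
      then show ?thesis by auto
    qed
    then show ?thesis by (auto simp: surj_def)
  qed
qed

lemma C_inv[simp]: "C (inv C x) = x"
  using bij_C by (simp add: bij_is_surj surj_f_inv_f)

lemma inv_C[simp]: "inv C (C x) = x"
  using bij_C by (simp add: bij_is_inj)

lemma inv_C_sym: "inv C u \<bullet> v = u \<bullet> inv C v"
  by (metis C_sym C_inv)

text \<open>Coercivity tested at \<open>inv C x\<close>, combined with Cauchy-Schwarz, gives the
  bound 1 / c.\<close>

lemma bounded_linear_inv_C: "bounded_linear (inv C)"
proof -
  obtain c where c: "c > 0" "\<And>u. c * (norm u)\<^sup>2 \<le> C u \<bullet> u" using C_coercive by blast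
  show ?thesis
  proof (rule bounded_linear_intro)
    show "inv C (x + y) = inv C x + inv C y" for x y
      by (metis C.add C_inv inv_C)
    show "inv C (r *\<^sub>R x) = r *\<^sub>R inv C x" for r x
      by (metis C.scaleR C_inv inv_C)
    show "norm (inv C x) \<le> norm x * (1 / c)" for x
    proof -
      have "c * (norm (inv C x))\<^sup>2 \<le> norm x * norm (inv C x)"
        using c(2)[of "inv C x"] norm_cauchy_schwarz[of x "inv C x"] by simp
      then have "c * norm (inv C x) \<le> norm x"
        by (cases "norm (inv C x) = 0") (auto simp: power2_eq_square)
      then show ?thesis using c(1) by (simp add: field_simps)
    qed
  qed
qed

sublocale inv_C: bounded_linear "inv C" by (rule bounded_linear_inv_C)

section \<open>The subspaces U and V and the adjoint of E\<close>

abbreviation "\<U> \<equiv> U_space W E C"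
abbreviation "\<V> \<equiv> adj_ker W E"

lemma U_iff: "u \<in> \<U> \<longleftrightarrow> inv C u \<in> E ` W"
  by (auto simp: U_space_def image_iff) (metis C_inv)

lemma C_in_U_iff: "C e \<in> \<U> \<longleftrightarrow> e \<in> E ` W"
  by (simp add: U_iff)

lemma subspace_U: "subspace \<U>"
  unfolding subspace_def
  using subspace_0[OF subspace_im] subspace_add[OF subspace_im] subspace_scale[OF subspace_im]
  by (simp add: U_iff inv_C.zero inv_C.add inv_C.scaleR)

text \<open>Both functionals are bounded on \<open>closure W\<close>, in which \<open>W\<close> is
  dense; outside it both vanish by the convention in \<open>subspace_dual\<close>. This makes the
  definite description in \<open>adj\<close> well defined.\<close>

lemma dual_unique:
  assumes "\<phi> \<in> subspace_dual (closure W)" "\<psi> \<in> subspace_dual (closure W)"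
    and eq: "\<And>w. w \<in> W \<Longrightarrow> \<phi> w = \<psi> w"
  shows "\<phi> = \<psi>"
proof
  have W: "subspace W" using lin_E by (simp add: linear_operator_on_def)
  fix x
  show "\<phi> x = \<psi> x"
  proof (cases "x \<in> closure W")
    case True
    obtain K L where K: "\<And>y. y \<in> closure W \<Longrightarrow> \<bar>\<phi> y\<bar> \<le> K * norm y"
      and L: "\<And>y. y \<in> closure W \<Longrightarrow> \<bar>\<psi> y\<bar> \<le> L * norm y"
      using assms(1,2) unfolding subspace_dual_def mem_Collect_eq by metis
    obtain s where s: "\<And>n. s n \<in> W" "s \<longlonglongrightarrow> x"
      using True closure_sequential by blast
    \<comment> \<open>The bounds \<open>K\<close> and \<open>L\<close> apply only on
      \<open>closure W\<close>, so the error has to be placed there, as the limit of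
      \<open>s k - s n\<close> in \<open>k\<close>.\<close>
    have clos: "x - s n \<in> closure W" for n
    proof -
      have "(\<lambda>k. s k - s n) \<longlonglongrightarrow> x - s n" using s(2) by (intro tendsto_intros)
      moreover have "s k - s n \<in> W" for k using W s(1) by (intro subspace_diff)
      ultimately show ?thesis unfolding closure_sequential by (intro exI[of _ "\<lambda>k. s k - s n"]) simp
    qed
    have add: "\<eta> (y + z) = \<eta> y + \<eta> z"
      if "\<eta> \<in> subspace_dual (closure W)" "y \<in> closure W" "z \<in> closure W" for \<eta> y z
      using that by (simp add: subspace_dual_def)
    have *: "\<bar>\<phi> x - \<psi> x\<bar> \<le> (K + L) * norm (x - s n)" for n
    proof -
      have sn: "s n \<in> closure W" using s(1) closure_subset by blast
      have "\<phi> x = \<phi> (s n) + \<phi> (x - s n)" "\<psi> x = \<psi> (s n) + \<psi> (x - s n)"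
        using add[OF assms(1) sn clos[of n]] add[OF assms(2) sn clos[of n]] by simp_all
      then show ?thesis
        using eq[OF s(1), of n] K[OF clos, of n] L[OF clos, of n] by (simp add: algebra_simps)
    qed
    have "(\<lambda>n. (K + L) * norm (x - s n)) \<longlonglongrightarrow> (K + L) * norm (x - x)"
      using s(2) by (intro tendsto_intros)
    then have "\<bar>\<phi> x - \<psi> x\<bar> \<le> 0"
      using * by (intro LIMSEQ_le_const) auto
    then show ?thesis by simp
  next
    case False
    then show ?thesis using assms(1,2) by (simp add: subspace_dual_def)
  qed
qed

lemma adj_eqI:
  assumes "\<phi> \<in> subspace_dual (closure W)" "\<And>w. w \<in> W \<Longrightarrow> \<phi> w = \<sigma> \<bullet> E w"
  shows "\<sigma> \<in> adj_dom W E" "adj W E \<sigma> = \<phi>"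
  using assms unfolding adj_dom_def adj_def by (auto intro!: the_equality intro: dual_unique)

lemma adj_in_dual: "\<sigma> \<in> adj_dom W E \<Longrightarrow> adj W E \<sigma> \<in> subspace_dual (closure W)"
  and adj_apply: "\<sigma> \<in> adj_dom W E \<Longrightarrow> w \<in> W \<Longrightarrow> adj W E \<sigma> w = \<sigma> \<bullet> E w"
  using adj_eqI unfolding adj_dom_def by auto

text \<open>Orthogonality to the image already yields membership in the domain of the adjoint, since
  the zero functional represents it.\<close>

lemma V_iff: "\<sigma> \<in> \<V> \<longleftrightarrow> (\<forall>w\<in>W. \<sigma> \<bullet> E w = 0)"
proof
  assume "\<sigma> \<in> \<V>"
  then show "\<forall>w\<in>W. \<sigma> \<bullet> E w = 0" using adj_apply[of \<sigma>] by (auto simp: adj_ker_def)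
next
  assume *: "\<forall>w\<in>W. \<sigma> \<bullet> E w = 0"
  have "(\<lambda>_. 0) \<in> subspace_dual (closure W)" by (auto simp: subspace_dual_def intro: exI[of _ 0])
  then show "\<sigma> \<in> \<V>" using adj_eqI[of "\<lambda>_. 0" \<sigma>] * by (auto simp: adj_ker_def)
qed

lemma subspace_V: "subspace \<V>"
  by (auto simp: subspace_def V_iff inner_simps)

lemma adj_add_ker:
  assumes "\<sigma> \<in> adj_dom W E" "\<tau> \<in> \<V>"
  shows "\<sigma> + \<tau> \<in> adj_dom W E" "adj W E (\<sigma> + \<tau>) = adj W E \<sigma>"
  using adj_eqI[OF adj_in_dual[OF assms(1)], of "\<sigma> + \<tau>"] adj_apply[OF assms(1)] assms(2)
  by (auto simp: V_iff inner_simps)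

lemma adj_eq_imp_diff_in_ker:
  assumes "\<sigma> \<in> adj_dom W E" "\<tau> \<in> adj_dom W E" "adj W E \<sigma> = adj W E \<tau>"
  shows "\<sigma> - \<tau> \<in> \<V>"
  using adj_apply[OF assms(1)] adj_apply[OF assms(2)] assms(3) by (auto simp: V_iff inner_simps)

text \<open>For \<open>u = C (E w)\<close> the symmetry of \<open>C\<close> cancels the weight and
  leaves the plain product of \<open>E w\<close> and \<open>v\<close>.\<close>

lemma U_orth_V: "u \<in> \<U> \<Longrightarrow> v \<in> \<V> \<Longrightarrow> winner C u v = 0"
  unfolding U_space_def winner_def V_iff by (auto simp: C_sym inner_commute)

lemma winner_self_zero: "winner C x x = 0 \<Longrightarrow> x = 0"
  by (metis C_inner_self_zero C_inv C.zero winner_def)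

section \<open>The projection onto U along V\<close>

text \<open>This is the orthogonal projection onto U for the weighted product, described through the
  splitting so that no inner product occurs.\<close>

definition P\<^sub>U :: "'h \<Rightarrow> 'h" where
  "P\<^sub>U x = (THE u. u \<in> \<U> \<and> x - u \<in> \<V>)"

text \<open>Two candidates differ by an element of both U and V, which is orthogonal to
  itself.\<close>

lemma P\<^sub>U_eqI:
  assumes "u \<in> \<U>" "x - u \<in> \<V>"
  shows "P\<^sub>U x = u"
  unfolding P\<^sub>U_def
proof (rule the_equality)
  fix u' assume u': "u' \<in> \<U> \<and> x - u' \<in> \<V>"
  have "u' - u \<in> \<U>" using u' assms subspace_U by (auto intro: subspace_diff)
  moreover have "u' - u \<in> \<V>"
    using subspace_diff[OF subspace_V assms(2), of "x - u'"] u' by simp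
  ultimately show "u' = u" using U_orth_V winner_self_zero by (metis eq_iff_diff_eq_0)
qed (use assms in auto)

lemma galerkin_decomposition: "\<exists>e\<in>E ` W. x - C e \<in> \<V>"
  using galerkin[OF subspace_im closed_im, of x] by (auto simp: V_iff)

lemma P\<^sub>U_in_U: "P\<^sub>U x \<in> \<U>" and diff_P\<^sub>U_in_V: "x - P\<^sub>U x \<in> \<V>"
  using galerkin_decomposition[of x] P\<^sub>U_eqI C_in_U_iff by metis+

lemma P\<^sub>U_eq_self_iff: "P\<^sub>U x = x \<longleftrightarrow> x \<in> \<U>"
  using P\<^sub>U_in_U[of x] P\<^sub>U_eqI[of x x] subspace_0[OF subspace_V] by auto

text \<open>The estimate is made for the strain \<open>inv C (P\<^sub>U x)\<close>, where coercivity
  of \<open>C\<close> applies directly; composing with \<open>C\<close> gives the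
  projection.\<close>

lemma bounded_linear_P\<^sub>U: "bounded_linear P\<^sub>U"
proof -
  obtain c where c: "c > 0" "\<And>u. c * (norm u)\<^sup>2 \<le> C u \<bullet> u" using C_coercive by blast
  have "bounded_linear (\<lambda>x. inv C (P\<^sub>U x))"
  proof (rule bounded_linear_intro)
    show "inv C (P\<^sub>U (x + y)) = inv C (P\<^sub>U x) + inv C (P\<^sub>U y)" for x y
    proof -
      have "P\<^sub>U (x + y) = P\<^sub>U x + P\<^sub>U y"
        using subspace_add[OF subspace_U P\<^sub>U_in_U P\<^sub>U_in_U]
          subspace_add[OF subspace_V diff_P\<^sub>U_in_V[of x] diff_P\<^sub>U_in_V[of y]]
        by (intro P\<^sub>U_eqI) (auto simp: algebra_simps)
      then show ?thesis by (simp add: inv_C.add)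
    qed
    show "inv C (P\<^sub>U (r *\<^sub>R x)) = r *\<^sub>R inv C (P\<^sub>U x)" for r x
    proof -
      have "P\<^sub>U (r *\<^sub>R x) = r *\<^sub>R P\<^sub>U x"
        using subspace_scale[OF subspace_U P\<^sub>U_in_U]
          subspace_scale[OF subspace_V diff_P\<^sub>U_in_V[of x], of r]
        by (intro P\<^sub>U_eqI) (auto simp: algebra_simps)
      then show ?thesis by (simp add: inv_C.scaleR)
    qed
    show "norm (inv C (P\<^sub>U x)) \<le> norm x * (1 / c)" for x
    proof -
      let ?e = "inv C (P\<^sub>U x)"
      \<comment> \<open>Orthogonality of the two components turns the product of \<open>x\<close>
        with the strain \<open>?e\<close> into the energy of \<open>?e\<close>.\<close>
      have "winner C (P\<^sub>U x) (x - P\<^sub>U x) = 0" using U_orth_V P\<^sub>U_in_U diff_P\<^sub>U_in_V by blast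
      then have "P\<^sub>U x \<bullet> inv C x = P\<^sub>U x \<bullet> ?e"
        by (simp add: winner_def inv_C.diff inner_diff_right)
      then have "x \<bullet> ?e = C ?e \<bullet> ?e"
        using inv_C_sym[of x "P\<^sub>U x"] by (simp add: inner_commute)
      then have "c * (norm ?e)\<^sup>2 \<le> norm x * norm ?e"
        using c(2)[of ?e] norm_cauchy_schwarz[of x ?e] by simp
      then have "c * norm ?e \<le> norm x"
        by (cases "norm ?e = 0") (auto simp: power2_eq_square)
      then show ?thesis using c(1) by (simp add: field_simps)
    qed
  qed
  from bounded_linear_compose[OF C this] show ?thesis by simp
qed

section \<open>The elastic stress, equilibrium and compatibility\<close>

text \<open>The projection onto V is the complement of that onto U. Uniqueness holds because the
  difference of two candidates lies in V and is orthogonal to V.\<close>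

lemma G_op_eq: "G_op W E C \<tau> = C \<tau> - P\<^sub>U (C \<tau>)"
  unfolding G_op_def orth_proj_def
proof (rule the_equality)
  let ?x = "C \<tau>"
  show "?x - P\<^sub>U ?x \<in> \<V> \<and> (\<forall>w\<in>\<V>. winner C (?x - (?x - P\<^sub>U ?x)) w = 0)"
    using diff_P\<^sub>U_in_V U_orth_V P\<^sub>U_in_U by simp
  fix v assume v: "v \<in> \<V> \<and> (\<forall>w\<in>\<V>. winner C (?x - v) w = 0)"
  let ?d = "?x - P\<^sub>U ?x - v"
  have d: "?d \<in> \<V>" using v diff_P\<^sub>U_in_V subspace_V by (auto intro: subspace_diff)
  have "winner C ?d ?d = winner C (?x - v) ?d - winner C (P\<^sub>U ?x) ?d"
    by (simp add: winner_def inner_diff_left)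
  then have "winner C ?d ?d = 0" using d v U_orth_V P\<^sub>U_in_U by simp
  then show "v = ?x - P\<^sub>U ?x" using winner_self_zero by fastforce
qed

lemma adj_P\<^sub>U:
  assumes "\<sigma> \<in> adj_dom W E"
  shows "P\<^sub>U \<sigma> \<in> adj_dom W E" "adj W E (P\<^sub>U \<sigma>) = adj W E \<sigma>"
proof -
  have "P\<^sub>U \<sigma> - \<sigma> \<in> \<V>" using subspace_neg[OF subspace_V diff_P\<^sub>U_in_V[of \<sigma>]] by simp
  from adj_add_ker[OF assms this] show "P\<^sub>U \<sigma> \<in> adj_dom W E" "adj W E (P\<^sub>U \<sigma>) = adj W E \<sigma>" by auto
qed

text \<open>Projecting to U changes a stress only by an element of V, so the load is kept; on U the
  load determines the stress because U and V meet only in zero.\<close>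

lemma Q_op_adj:
  assumes "\<sigma> \<in> adj_dom W E"
  shows "Q_op W E C (adj W E \<sigma>) = P\<^sub>U \<sigma>"
  unfolding Q_op_def
proof (rule the_inv_into_f_eq)
  show "inj_on (adj W E) (\<U> \<inter> adj_dom W E)"
  proof (rule inj_onI)
    fix u v assume u: "u \<in> \<U> \<inter> adj_dom W E" and v: "v \<in> \<U> \<inter> adj_dom W E"
      and eq: "adj W E u = adj W E v"
    have "u - v \<in> \<V>" using u v eq by (intro adj_eq_imp_diff_in_ker) auto
    then show "u = v" using u v P\<^sub>U_eqI P\<^sub>U_eq_self_iff by (metis IntD1)
  qed
qed (use adj_P\<^sub>U[OF assms] P\<^sub>U_in_U in auto)

lemma elastic_stress_eq:
  assumes "\<sigma> \<in> adj_dom W E" "adj W E \<sigma> = f t"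
  shows "elastic_stress W E C g f t = C (g t) - P\<^sub>U (C (g t)) + P\<^sub>U \<sigma>"
  using Q_op_adj[OF assms(1)] assms(2) by (simp add: elastic_stress_def G_op_eq)

text \<open>The elastic stress carries the load itself: it is the U-part of any stress in
  equilibrium plus an element of V. Stresses with equal load differ by elements of V.\<close>

lemma equilibrium_iff:
  assumes "f t \<in> adj_im W E"
  shows "\<sigma> \<in> adj_dom W E \<and> adj W E \<sigma> = f t \<longleftrightarrow> \<sigma> - elastic_stress W E C g f t \<in> \<V>"
proof
  assume *: "\<sigma> \<in> adj_dom W E \<and> adj W E \<sigma> = f t"
  have "(\<sigma> - P\<^sub>U \<sigma>) - (C (g t) - P\<^sub>U (C (g t))) \<in> \<V>"
    by (intro subspace_diff[OF subspace_V] diff_P\<^sub>U_in_V)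
  then show "\<sigma> - elastic_stress W E C g f t \<in> \<V>"
    using * by (simp add: elastic_stress_eq[of \<sigma>] algebra_simps)
next
  assume *: "\<sigma> - elastic_stress W E C g f t \<in> \<V>"
  \<comment> \<open>Solvability of the load supplies a reference stress through which the elastic
    stress can be computed.\<close>
  obtain \<tau> where \<tau>: "\<tau> \<in> adj_dom W E" "adj W E \<tau> = f t"
    using assms by (auto simp: adj_im_def)
  have "(\<sigma> - elastic_stress W E C g f t) + (C (g t) - P\<^sub>U (C (g t))) \<in> \<V>"
    by (intro subspace_add[OF subspace_V] diff_P\<^sub>U_in_V *)
  then have "\<sigma> - P\<^sub>U \<tau> \<in> \<V>"
    using \<tau> by (simp add: elastic_stress_eq[of \<tau>] algebra_simps)
  from adj_add_ker[OF adj_P\<^sub>U(1)[OF \<tau>(1)] this] adj_P\<^sub>U(2)[OF \<tau>(1)]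
  show "\<sigma> \<in> adj_dom W E \<and> adj W E \<sigma> = f t" using \<tau>(2) by simp
qed

text \<open>The elastic stress and \<open>C (g t)\<close> differ by the element
  \<open>P\<^sub>U \<sigma> - P\<^sub>U (C (g t))\<close> of U.\<close>

lemma compatibility_iff:
  assumes "\<sigma> \<in> adj_dom W E" "adj W E \<sigma> = f t"
  shows "e \<in> (\<lambda>d. d + g t) ` (E ` W) \<longleftrightarrow> C e - elastic_stress W E C g f t \<in> \<U>"
proof -
  have "e \<in> (\<lambda>d. d + g t) ` (E ` W) \<longleftrightarrow> e - g t \<in> E ` W"
    by (metis (no_types, lifting) add_diff_cancel diff_add_cancel image_iff)
  also have "\<dots> \<longleftrightarrow> C e - C (g t) \<in> \<U>"
    by (simp add: C.diff[symmetric] C_in_U_iff)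
  also have "\<dots> \<longleftrightarrow> C e - C (g t) + (P\<^sub>U (C (g t)) - P\<^sub>U \<sigma>) \<in> \<U>"
    using subspace_U P\<^sub>U_in_U by (metis add_diff_cancel subspace_add subspace_diff)
  finally show ?thesis
    by (simp add: elastic_stress_eq[of \<sigma>] assms algebra_simps)
qed

section \<open>Normal cones and the flow rule\<close>

text \<open>Here \<open>e\<close>, \<open>a\<close>, \<open>b\<close>, \<open>z\<close> stand for
  the rates of strain, stress, elastic stress and internal variable. The factor \<open>{0}\<close>
  forces the second cone component to be \<open>- z\<close>, and the first is then
  \<open>C e - a\<close>. Passing from the plain to the weighted cone multiplies the first component
  by \<open>C\<close>, which the weight cancels.\<close>

lemma flow_rule_iff:
  "e \<in> inv C ` ((\<lambda>s. s + b) `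
      (fst ` (((\<lambda>n. n + (a - b, z)) ` normal_cone (winner_hat C) (shifted_set \<Sigma> s) (\<sigma> - s, \<xi>))
         \<inter> (\<U> \<times> {0})))) \<longleftrightarrow>
   C e - b \<in> \<U> \<and> (e - inv C a, - z) \<in> normal_cone (\<bullet>) \<Sigma> (\<sigma>, \<xi>)" (is "?L \<longleftrightarrow> _ \<and> ?R")
proof -
  have cone: "(C p, - z) \<in> normal_cone (winner_hat C) (shifted_set \<Sigma> s) (\<sigma> - s, \<xi>) \<longleftrightarrow>
      (p, - z) \<in> normal_cone (\<bullet>) \<Sigma> (\<sigma>, \<xi>)" for p
  proof -
    have "(\<sigma> - s, \<xi>) \<in> shifted_set \<Sigma> s \<longleftrightarrow> (\<sigma>, \<xi>) \<in> \<Sigma>"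
      by (force simp: shifted_set_def)
    moreover have "winner_hat C (C p, - z) (c - (s, 0) - (\<sigma> - s, \<xi>)) = (p, - z) \<bullet> (c - (\<sigma>, \<xi>))"
      for c
      by (simp add: winner_hat_def winner_def inner_prod_def C_sym)
    ultimately show ?thesis by (simp add: normal_cone_def shifted_set_def)
  qed
  have "?L \<longleftrightarrow> C e - b \<in> \<U> \<and> (C (e - inv C a), - z) \<in>
      normal_cone (winner_hat C) (shifted_set \<Sigma> s) (\<sigma> - s, \<xi>)"
    (is "_ \<longleftrightarrow> _ \<and> _ \<in> ?N")
  proof
    assume ?L
    then obtain n m where *: "(n, m) \<in> ?N" "(n + (a - b), m + z) \<in> \<U> \<times> {0}"
      "e = inv C (n + (a - b) + b)" by auto
    have "C e = n + a" using *(3) by simp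
    moreover have "m = - z" using *(2) by (simp add: eq_neg_iff_add_eq_0)
    ultimately show "C e - b \<in> \<U> \<and> (C (e - inv C a), - z) \<in> ?N"
      using * by (simp add: C.diff algebra_simps)
  next
    assume *: "C e - b \<in> \<U> \<and> (C (e - inv C a), - z) \<in> ?N"
    have "(C e - b, 0) = (C (e - inv C a), - z) + (a - b, z)" by (simp add: C.diff)
    then have "(C e - b, 0) \<in> ((\<lambda>n. n + (a - b, z)) ` ?N) \<inter> (\<U> \<times> {0})"
      using * by blast
    then have "C e - b \<in> fst ` (((\<lambda>n. n + (a - b, z)) ` ?N) \<inter> (\<U> \<times> {0}))"
      by (metis fst_conv image_eqI)
    then have "C e - b + b \<in> (\<lambda>s. s + b) ` (fst ` (((\<lambda>n. n + (a - b, z)) ` ?N) \<inter> (\<U> \<times> {0})))"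
      by (rule imageI)
    from imageI[OF this, of "inv C"] show ?L by simp
  qed
  then show ?thesis by (simp add: cone)
qed

text \<open>The vector \<open>- (a - b)\<close> differs from \<open>C (e - inv C a)\<close> by
  \<open>C e - b\<close>, an element of U. Test directions inside the moving set have first
  component in V, so this difference does not contribute and the inequality of the flow rule carries
  over.\<close>

lemma flow_rule_imp_sweeping:
  assumes flow: "(e - inv C a, - z) \<in> normal_cone (\<bullet>) \<Sigma> (\<sigma>, \<xi>)"
    and U: "C e - b \<in> \<U>" and V: "\<sigma> - s \<in> \<V>"
  shows "- (a - b, z) \<in> normal_cone (winner_hat C) (moving_set W E \<Sigma> s) (\<sigma> - s, \<xi>)"
  unfolding normal_cone_def
proof (intro CollectI conjI ballI)
  have "(\<sigma>, \<xi>) \<in> \<Sigma>" using flow by (simp add: normal_cone_def)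
  then show "(\<sigma> - s, \<xi>) \<in> moving_set W E \<Sigma> s"
    using V by (force simp: moving_set_def shifted_set_def)
next
  fix c assume "c \<in> moving_set W E \<Sigma> s"
  then obtain \<tau> \<zeta> where c: "c = (\<tau> - s, \<zeta>)" "(\<tau>, \<zeta>) \<in> \<Sigma>" "\<tau> - s \<in> \<V>"
    by (auto simp: moving_set_def shifted_set_def)
  have "\<tau> - \<sigma> \<in> \<V>" using subspace_diff[OF subspace_V c(3) V] by simp
  from U_orth_V[OF U this] have "(C e - b) \<bullet> inv C (\<tau> - \<sigma>) = 0" by (simp add: winner_def)
  then have "- (a - b) \<bullet> inv C (\<tau> - \<sigma>) = C (e - inv C a) \<bullet> inv C (\<tau> - \<sigma>)"
    by (simp add: C.diff inner_simps)
  also have "\<dots> = (e - inv C a) \<bullet> (\<tau> - \<sigma>)" by (simp add: C_sym)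
  finally show "winner_hat C (- (a - b, z)) (c - (\<sigma> - s, \<xi>)) \<le> 0"
    using flow c(2) by (auto simp: normal_cone_def winner_hat_def winner_def c(1))
qed

end

section \<open>The equivalence\<close>

theorem theorem6p1:
  fixes T :: real
    and W0 :: "'x::banach set"
    and E :: "'x \<Rightarrow> 'h::{real_inner, banach, second_countable_topology}"
    and C :: "'h \<Rightarrow> 'h"
    and g :: "real \<Rightarrow> 'h"
    and f :: "real \<Rightarrow> 'x \<Rightarrow> real"
    and \<Sigma> :: "('h \<times> 'k::{real_inner, banach, second_countable_topology}) set"
    and \<epsilon> \<epsilon>el \<epsilon>p \<sigma> \<sigma>' y :: "real \<Rightarrow> 'h"
    and \<xi> :: "real \<Rightarrow> 'k"
    and \<epsilon>0 \<epsilon>el0 \<epsilon>p0 \<sigma>0 :: 'h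
    and \<xi>0 :: 'k
  assumes "T > 0"
    and "reflexive_space TYPE('x)"
    and "linear_operator_on W0 E" and "closed_operator_on W0 E" and "closed (E ` W0)"
    and "bounded_linear C" and "symmetric_coercive C"
    and "W1inf T g"
    and "W1inf_dual T (closure W0) (adj_im W0 E) f"
    and "closed \<Sigma>" and "convex \<Sigma>" and "\<Sigma> \<noteq> {}"
    and "EMP_static W0 E C (g 0) (f 0) \<epsilon>0 \<epsilon>el0 \<epsilon>p0 \<sigma>0" and "(\<sigma>0, \<xi>0) \<in> \<Sigma>"
    and "W1inf T \<epsilon>" and "W1inf T \<epsilon>el" and "W1inf T \<epsilon>p" and "W1inf T \<sigma>" and "W1inf T \<xi>"
    and "\<And>t. t \<in> {0..T} \<Longrightarrow> \<epsilon>el t = inv C (\<sigma> t)"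
    and "\<And>t. t \<in> {0..T} \<Longrightarrow> \<epsilon>p t = \<epsilon> t - \<epsilon>el t"
    and "\<sigma>' = elastic_stress W0 E C g f"
    and "y = (\<lambda>t. \<sigma> t - \<sigma>' t)"
  shows "solves_EMP T W0 E C g f \<Sigma> (\<epsilon>0, \<epsilon>el0, \<epsilon>p0, \<sigma>0, \<xi>0) \<epsilon> \<epsilon>el \<epsilon>p \<sigma> \<xi> \<longleftrightarrow>
    (\<forall>t\<in>{0..T}. (y t, \<xi> t) \<in> moving_set W0 E \<Sigma> (\<sigma>' t)) \<and>
    (AE t in lebesgue_on {0..T}.
       - ddt T (\<lambda>r. (y r, \<xi> r)) t
         \<in> normal_cone (winner_hat C) (moving_set W0 E \<Sigma> (\<sigma>' t)) (y t, \<xi> t)) \<and>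
    (AE t in lebesgue_on {0..T}.
       ddt T \<epsilon> t \<in> inv C ` ((\<lambda>s. s + ddt T \<sigma>' t) `
         (fst ` (((\<lambda>n. n + ddt T (\<lambda>r. (y r, \<xi> r)) t) `
                    normal_cone (winner_hat C) (shifted_set \<Sigma> (\<sigma>' t)) (y t, \<xi> t))
                 \<inter> (U_space W0 E C \<times> {0}))))) \<and>
    y 0 = \<sigma>0 - \<sigma>' 0 \<and> \<xi> 0 = \<xi>0 \<and> (y 0, \<xi> 0) \<in> moving_set W0 E \<Sigma> (\<sigma>' 0) \<and>
    \<epsilon> 0 = \<epsilon>0 \<and> \<epsilon>0 \<in> inv C ` ((\<lambda>u. u + \<sigma>' 0) ` U_space W0 E C)"
proof -
  interpret elastic_operators W0 E C
    by (intro elastic_operators.intro assms)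
  define a where "a = ddt T \<sigma>"
  define e where "e = ddt T \<epsilon>"
  define z where "z = ddt T \<xi>"
  \<comment> \<open>Candidate density of the elastic stress, obtained by differentiating the formula
    in \<open>elastic_stress_eq\<close>.\<close>
  define b where "b = (\<lambda>t. C (ddt T g t) - P\<^sub>U (C (ddt T g t)) + P\<^sub>U (a t))"
  have d\<sigma>: "is_weak_derivative T \<sigma> a" and d\<epsilon>: "is_weak_derivative T \<epsilon> e"
    and d\<xi>: "is_weak_derivative T \<xi> z"
    using assms(15,18,19) unfolding a_def e_def z_def by (blast intro: weak_derivative_ddt)+
  have load: "f t \<in> adj_im W0 E" if "t \<in> {0..T}" for t
    using assms(9) that by (simp add: W1inf_dual_def)
  have zero_in: "0 \<in> {0..T}" using \<open>T > 0\<close> by simp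
  have elastic_law: "\<sigma> t = C (\<epsilon>el t)" "\<epsilon> t = \<epsilon>el t + \<epsilon>p t" if "t \<in> {0..T}" for t
    using assms(20,21)[OF that] by simp_all
  have static_iff: "EMP_static W0 E C (g t) (f t) (\<epsilon> t) (\<epsilon>el t) (\<epsilon>p t) (\<sigma> t) \<longleftrightarrow>
      y t \<in> \<V> \<and> C (\<epsilon> t) - \<sigma>' t \<in> \<U>" if "t \<in> {0..T}" for t
    using elastic_law[OF that] equilibrium_iff[of f t "\<sigma> t" g, OF load[OF that]]
      compatibility_iff[of "\<sigma> t" f t "\<epsilon> t" g]
    unfolding EMP_static_def assms(22,23) by blast
  have init: "C \<epsilon>0 - \<sigma>' 0 \<in> \<U>"
    using assms(13) compatibility_iff[of \<sigma>0 f 0 \<epsilon>0 g]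
    unfolding EMP_static_def assms(22) by blast
  have init': "\<epsilon>0 \<in> inv C ` ((\<lambda>u. u + \<sigma>' 0) ` U_space W0 E C)"
  proof -
    have "\<epsilon>0 = inv C ((C \<epsilon>0 - \<sigma>' 0) + \<sigma>' 0)" by simp
    then show ?thesis using init by blast
  qed
  have init_el: "\<epsilon>el0 = inv C \<sigma>0" "\<epsilon>p0 = \<epsilon>0 - \<epsilon>el0"
    using assms(13) by (auto simp: EMP_static_def)
  define flow where "flow = (\<lambda>t. (e t - inv C (a t), - z t) \<in> normal_cone (\<bullet>) \<Sigma> (\<sigma> t, \<xi> t))"
  have ddt_p: "AE t in lebesgue_on {0..T}. ddt T (\<lambda>r. (\<epsilon>p r, - \<xi> r)) t = (e t - inv C (a t), - z t)"
  proof (rule ddt_AE_eq, rule weak_derivative_cong)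
    show "is_weak_derivative T (\<lambda>t. (\<epsilon> t - inv C (\<sigma> t), - \<xi> t)) (\<lambda>t. (e t - inv C (a t), - z t))"
      by (intro weak_derivative_Pair weak_derivative_diff d\<epsilon> d\<sigma> d\<xi>
          weak_derivative_bounded_linear[OF bounded_linear_inv_C]
          weak_derivative_bounded_linear[OF bounded_linear_minus[OF bounded_linear_ident]])
  qed (use assms(20,21) in simp)
  \<comment> \<open>Equilibrium at every time is assumed because the formula for \<sigma>', and with
    it the density \<open>b\<close>, is derived from it.\<close>
  have main: ?thesis if equi: "\<And>t. t \<in> {0..T} \<Longrightarrow> y t \<in> \<V>"
  proof -
    have stress: "\<sigma>' t = C (g t) - P\<^sub>U (C (g t)) + P\<^sub>U (\<sigma> t)" if t: "t \<in> {0..T}" for t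
      using elastic_stress_eq[of "\<sigma> t" f t g] equilibrium_iff[of f t "\<sigma> t" g, OF load[OF t]] equi[OF t]
      by (simp add: assms(22,23))
    have d\<sigma>': "is_weak_derivative T \<sigma>' b"
    proof (rule weak_derivative_cong)
      show "is_weak_derivative T (\<lambda>t. C (g t) - P\<^sub>U (C (g t)) + P\<^sub>U (\<sigma> t)) b"
        unfolding b_def
        by (intro weak_derivative_add weak_derivative_diff d\<sigma>
            weak_derivative_bounded_linear[OF bounded_linear_P\<^sub>U]
            weak_derivative_bounded_linear[OF C] weak_derivative_ddt assms(8))
    qed (rule stress)
    have ddt_\<sigma>': "AE t in lebesgue_on {0..T}. ddt T \<sigma>' t = b t"
      by (rule ddt_AE_eq[OF d\<sigma>'])
    have ddt_y: "AE t in lebesgue_on {0..T}. ddt T (\<lambda>r. (y r, \<xi> r)) t = (a t - b t, z t)"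
      unfolding assms(23) by (intro ddt_AE_eq weak_derivative_Pair weak_derivative_diff d\<sigma> d\<sigma>' d\<xi>)
    \<comment> \<open>U is the kernel of the identity minus the projection, and the initial value
      lies in U by \<open>init\<close>.\<close>
    have compat: "(AE t in lebesgue_on {0..T}. C (e t) - b t \<in> \<U>) \<longleftrightarrow>
        (\<forall>t\<in>{0..T}. C (\<epsilon> t) - \<sigma>' t \<in> \<U>)" if "\<epsilon> 0 = \<epsilon>0"
    proof -
      have U: "x \<in> \<U> \<longleftrightarrow> x - P\<^sub>U x = 0" for x using P\<^sub>U_eq_self_iff[of x] by auto
      have "bounded_linear (\<lambda>x. x - P\<^sub>U x)"
        by (intro bounded_linear_sub bounded_linear_ident bounded_linear_P\<^sub>U)
      moreover have "is_weak_derivative T (\<lambda>t. C (\<epsilon> t) - \<sigma>' t) (\<lambda>t. C (e t) - b t)"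
        by (intro weak_derivative_diff d\<sigma>' weak_derivative_bounded_linear[OF C] d\<epsilon>)
      moreover have "(C (\<epsilon> 0) - \<sigma>' 0) - P\<^sub>U (C (\<epsilon> 0) - \<sigma>' 0) = 0"
        using init that U by simp
      ultimately show ?thesis unfolding U by (rule weak_derivative_in_kernel_iff)
    qed
    have flow_iff: "(AE t in lebesgue_on {0..T}.
        ddt T (\<lambda>r. (\<epsilon>p r, - \<xi> r)) t \<in> normal_cone (\<bullet>) \<Sigma> (\<sigma> t, \<xi> t)) \<longleftrightarrow>
        (AE t in lebesgue_on {0..T}. flow t)"
      by (rule eventually_subst) (use ddt_p in \<open>eventually_elim, simp add: flow_def\<close>)
    have strain_iff: "(AE t in lebesgue_on {0..T}.
        ddt T \<epsilon> t \<in> inv C ` ((\<lambda>s. s + ddt T \<sigma>' t) `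
          (fst ` (((\<lambda>n. n + ddt T (\<lambda>r. (y r, \<xi> r)) t) `
                     normal_cone (winner_hat C) (shifted_set \<Sigma> (\<sigma>' t)) (y t, \<xi> t))
                  \<inter> (\<U> \<times> {0}))))) \<longleftrightarrow>
        (AE t in lebesgue_on {0..T}. C (e t) - b t \<in> \<U> \<and> flow t)"
    proof (rule eventually_subst)
      show "AE t in lebesgue_on {0..T}. (ddt T \<epsilon> t \<in> inv C ` ((\<lambda>s. s + ddt T \<sigma>' t) `
          (fst ` (((\<lambda>n. n + ddt T (\<lambda>r. (y r, \<xi> r)) t) `
                     normal_cone (winner_hat C) (shifted_set \<Sigma> (\<sigma>' t)) (y t, \<xi> t))
                  \<inter> (\<U> \<times> {0}))))) = (C (e t) - b t \<in> \<U> \<and> flow t)"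
        using ddt_\<sigma>' ddt_y
      proof eventually_elim
        case (elim t)
        have "y t = \<sigma> t - \<sigma>' t" by (simp add: assms(23))
        then show ?case
          unfolding elim flow_def e_def[symmetric] by (simp only: flow_rule_iff)
      qed
    qed
    have moving_iff: "(y t, \<xi> t) \<in> moving_set W0 E \<Sigma> (\<sigma>' t) \<longleftrightarrow> (\<sigma> t, \<xi> t) \<in> \<Sigma> \<and> y t \<in> \<V>" for t
      by (force simp: moving_set_def shifted_set_def assms(23))
    have lhs_iff: "solves_EMP T W0 E C g f \<Sigma> (\<epsilon>0, \<epsilon>el0, \<epsilon>p0, \<sigma>0, \<xi>0) \<epsilon> \<epsilon>el \<epsilon>p \<sigma> \<xi> \<longleftrightarrow>
        (\<forall>t\<in>{0..T}. C (\<epsilon> t) - \<sigma>' t \<in> \<U>) \<and> (AE t in lebesgue_on {0..T}. flow t) \<and>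
        \<sigma> 0 = \<sigma>0 \<and> \<xi> 0 = \<xi>0 \<and> \<epsilon> 0 = \<epsilon>0"
      using assms(15-19) equi static_iff init_el assms(20,21)[OF zero_in]
      unfolding solves_EMP_def flow_iff by auto
    \<comment> \<open>The flow rule yields admissibility for almost all times; closedness of
      \<Sigma> and continuity extend it to all times, as the moving set condition demands.\<close>
    have admissible: "(\<sigma> t, \<xi> t) \<in> \<Sigma>"
      if "AE t in lebesgue_on {0..T}. flow t" "t \<in> {0..T}" for t
    proof -
      have "AE t in lebesgue_on {0..T}. (\<sigma> t, \<xi> t) \<in> \<Sigma>"
        using that(1) by eventually_elim (simp add: flow_def normal_cone_def)
      then show ?thesis
        using AE_closed_imp_all[OF \<open>T > 0\<close> weak_derivative_continuous[OF weak_derivative_Pair[OF d\<sigma> d\<xi>]]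
            \<open>closed \<Sigma>\<close>] that(2) by blast
    qed
    have sweeping: "AE t in lebesgue_on {0..T}. - ddt T (\<lambda>r. (y r, \<xi> r)) t
         \<in> normal_cone (winner_hat C) (moving_set W0 E \<Sigma> (\<sigma>' t)) (y t, \<xi> t)"
      if "AE t in lebesgue_on {0..T}. C (e t) - b t \<in> \<U> \<and> flow t"
      using that ddt_y AE_space
    proof eventually_elim
      case (elim t)
      have y: "y t = \<sigma> t - \<sigma>' t" by (simp add: assms(23))
      have "y t \<in> \<V>" using elim(3) by (intro equi) (simp add: space_restrict_space)
      then show ?case
        using elim(1) flow_rule_imp_sweeping unfolding elim(2) flow_def y by blast
    qed
    have y0: "y 0 = \<sigma>0 - \<sigma>' 0 \<longleftrightarrow> \<sigma> 0 = \<sigma>0" by (auto simp: assms(23))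
    show ?thesis
      unfolding lhs_iff moving_iff strain_iff y0
    proof (intro iffI)
      assume L: "(\<forall>t\<in>{0..T}. C (\<epsilon> t) - \<sigma>' t \<in> \<U>) \<and> (AE t in lebesgue_on {0..T}. flow t) \<and>
        \<sigma> 0 = \<sigma>0 \<and> \<xi> 0 = \<xi>0 \<and> \<epsilon> 0 = \<epsilon>0"
      then have "AE t in lebesgue_on {0..T}. C (e t) - b t \<in> \<U> \<and> flow t"
        using compat by simp
      then show "(\<forall>t\<in>{0..T}. (\<sigma> t, \<xi> t) \<in> \<Sigma> \<and> y t \<in> \<V>) \<and>
        (AE t in lebesgue_on {0..T}. - ddt T (\<lambda>r. (y r, \<xi> r)) t
           \<in> normal_cone (winner_hat C) (moving_set W0 E \<Sigma> (\<sigma>' t)) (y t, \<xi> t)) \<and>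
        (AE t in lebesgue_on {0..T}. C (e t) - b t \<in> \<U> \<and> flow t) \<and>
        \<sigma> 0 = \<sigma>0 \<and> \<xi> 0 = \<xi>0 \<and> ((\<sigma> 0, \<xi> 0) \<in> \<Sigma> \<and> y 0 \<in> \<V>) \<and>
        \<epsilon> 0 = \<epsilon>0 \<and> \<epsilon>0 \<in> inv C ` ((\<lambda>u. u + \<sigma>' 0) ` \<U>)"
        using L equi admissible sweeping zero_in init' by blast
    \<comment> \<open>Conversely, the strain inclusion contains the flow rule, and
      \<open>compat\<close> integrates its other half to compatibility at all times.\<close>
    qed (use compat in simp)
  qed
  show ?thesis
  \<comment> \<open>If some \<open>y t\<close> lies outside V, both sides fail: the left by
    equilibrium, the right because the moving set has first components in V.\<close>
  proof (cases "\<forall>t\<in>{0..T}. y t \<in> \<V>")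
    case True
    then show ?thesis using main by blast
  next
    case False
    then show ?thesis
      unfolding solves_EMP_def moving_set_def using static_iff by blast
  qed
qed

end
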